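(* Let $G$ be a graph with clique number $\omega$, let $t$ be an integer with $2\le t\le \omega$, and let $\rho_t(G)$ be the $t$-clique spectral radius of $G$. Then $$\rho_{t}(G)\le t\left( \sum_{v\in V(G)} \sqrt[t-1]{\binom{\alpha(v)}{t}\left(\alpha(v)\right)^{-t}} \right)^{t-1}.$$ Equality holds if and only if the graph obtained from $G$ by deleting all edges not contained in $t$-cliques of $G$ is a complete regular $\omega$-partite graph, possibly together with some isolated vertices.
   Context: All graphs are finite, simple and undirected. A clique of $G$ is a set of vertices whose induced subgraph is complete; a $t$-clique is a clique with exactly $t$ vertices; $C_t(G)$ is the set of all $t$-cliques of $G$. The clique number $\omega=\omega(G)$ is the number of vertices of a largest clique. For a vertex $v$, $\alpha(v)$ is the number of vertices of the largest clique of $G$ containing $v$. As usual $\binom{m}{t}=0$ for $0\le m<t$. An edge is contained in a $t$-clique if both its endpoints belong to that $t$-clique. For $V(G)=[n]=\{1,\dots,n\}$ and $2\le t\le\omega(G)$, the $t$-clique tensor $\mathcal{A}(G)=(a_{i_1i_2\cdots i_t})$ is the $t$-order $n$-dimensional tensor with $a_{i_1\cdots i_t}=\frac{1}{(t-1)!}$ if $\{i_1,\dots,i_t\}\in C_t(G)$ and $a_{i_1\cdots i_t}=0$ otherwise. A number $\lambda\in\mathbb{C}$ is an eigenvalue of a $t$-order $n$-dimensional tensor $\mathcal{A}$ if there is a nonzero $x\in\mathbb{C}^n$ with $\sum_{i_2,\dots,i_t=1}^n a_{i i_2\cdots i_t}x_{i_2}\cdots x_{i_t}=\lambda x_i^{t-1}$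 for all $i\in[n]$. The spectral radius of $\mathcal{A}$ is the maximum modulus of its eigenvalues, and the $t$-clique spectral radius $\rho_t(G)$ is the spectral radius of the $t$-clique tensor of $G$. A complete regular $\omega$-partite graph has its vertex set partitioned into $\omega$ nonempty classes of equal size, two vertices being adjacent exactly when they lie in different classes. "Possibly together with some isolated vertices" means that the graph is the disjoint union of such a graph and a (possibly empty) set of isolated vertices. *)

theory Defs
  imports Complex_Main "HOL-Library.Disjoint_Sets"
begin

(* A graph is given by its vertex set V and its set E of edges, an edge being the set of its
   two endpoints. *)
definition simple_graph :: "'a set \<Rightarrow> 'a set set \<Rightarrow> bool" where
  "simple_graph V E \<longleftrightarrow> finite V \<and> (\<forall>e\<in>E. e \<subseteq> V \<and> card e = 2)"

definition clique :: "'a set \<Rightarrow> 'a set set \<Rightarrow> 'a set \<Rightarrow> bool" where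
  "clique V E K \<longleftrightarrow> K \<subseteq> V \<and> (\<forall>u\<in>K. \<forall>v\<in>K. u \<noteq> v \<longrightarrow> {u, v} \<in> E)"

definition cliques :: "'a set \<Rightarrow> 'a set set \<Rightarrow> nat \<Rightarrow> 'a set set" where
  "cliques V E t = {K. clique V E K \<and> card K = t}"

definition clique_number :: "'a set \<Rightarrow> 'a set set \<Rightarrow> nat" where
  "clique_number V E = Max {card K |K. clique V E K}"

definition vertex_clique_number :: "'a set \<Rightarrow> 'a set set \<Rightarrow> 'a \<Rightarrow> nat" where
  "vertex_clique_number V E v = Max {card K |K. clique V E K \<and> v \<in> K}"

(* A tensor of order t with index set V is a function on lists of indices, of which only the
   values at lists of length t over V matter; likewise only the values of x on V matter. *)
definition tensor_eigenvalue :: "'a set \<Rightarrow> nat \<Rightarrow> ('a list \<Rightarrow> complex) \<Rightarrow> complex \<Rightarrow> bool" where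
  "tensor_eigenvalue V t A l \<longleftrightarrow>
     (\<exists>x :: 'a \<Rightarrow> complex. (\<exists>i\<in>V. x i \<noteq> 0) \<and>
        (\<forall>i\<in>V. (\<Sum>js | set js \<subseteq> V \<and> length js = t - 1. A (i # js) * prod_list (map x js))
                 = l * x i ^ (t - 1)))"

definition tensor_spectral_radius :: "'a set \<Rightarrow> nat \<Rightarrow> ('a list \<Rightarrow> complex) \<Rightarrow> real" where
  "tensor_spectral_radius V t A = Sup {cmod l |l. tensor_eigenvalue V t A l}"

(* The supremum above is the maximum modulus. *)
lemma tensor_spectral_radius_eq_maximum:
  assumes "tensor_eigenvalue V t A l"
    and "\<And>m. tensor_eigenvalue V t A m \<Longrightarrow> cmod m \<le> cmod l"
  shows "tensor_spectral_radius V t A = cmod l"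
  unfolding tensor_spectral_radius_def by (rule cSup_eq_maximum) (use assms in auto)

definition clique_tensor :: "'a set \<Rightarrow> 'a set set \<Rightarrow> nat \<Rightarrow> 'a list \<Rightarrow> complex" where
  "clique_tensor V E t js = (if set js \<in> cliques V E t then 1 / fact (t - 1) else 0)"

definition clique_spectral_radius :: "'a set \<Rightarrow> 'a set set \<Rightarrow> nat \<Rightarrow> real" where
  "clique_spectral_radius V E t = tensor_spectral_radius V t (clique_tensor V E t)"

definition clique_edges :: "'a set \<Rightarrow> 'a set set \<Rightarrow> nat \<Rightarrow> 'a set set" where
  "clique_edges V E t = {e \<in> E. \<exists>K \<in> cliques V E t. e \<subseteq> K}"

definition complete_regular_partite :: "nat \<Rightarrow> 'a set \<Rightarrow> 'a set set \<Rightarrow> bool" where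
  "complete_regular_partite k V E \<longleftrightarrow>
     (\<exists>P. partition_on V P \<and> finite P \<and> card P = k \<and> (\<exists>s. \<forall>C\<in>P. card C = s) \<and>
          E = {{u, v} |u v. u \<in> V \<and> v \<in> V \<and> \<not> (\<exists>C\<in>P. u \<in> C \<and> v \<in> C)})"

(* All edges have their endpoints in W, so the vertices of V - W are isolated. *)
definition complete_regular_partite_isolated :: "nat \<Rightarrow> 'a set \<Rightarrow> 'a set set \<Rightarrow> bool" where
  "complete_regular_partite_isolated k V E \<longleftrightarrow>
     (\<exists>W \<subseteq> V. complete_regular_partite k W E)"

end

theory Submission
  imports Defs "HOL-Analysis.Function_Topology" "HOL-Combinatorics.Multiset_Permutations"
begin

text \<open>
  Let \<open>p\<close> be the clique polynomial, the sum over all \<open>t\<close>-cliques of the products of their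
  variables. The left-hand side of the eigenvalue equation for the clique tensor at \<open>i\<close> is
  the partial derivative of \<open>p\<close> with respect to \<open>x i\<close>. Hence the spectral radius is \<open>t\<close>
  times the maximum of \<open>p\<close> over nonnegative vectors whose \<open>t\<close>-th powers sum to 1: a
  maximizer satisfies the Lagrange condition, and moduli of eigenvectors cannot do better by
  Euler's identity (\<open>clique_spectral_radius_eq_max\<close>).

  Let \<open>c v\<close> be \<open>(a choose t) / a ^ t\<close>, where \<open>a\<close> is the size of a largest clique through
  \<open>v\<close>. The bound is the composition of two inequalities for nonnegative \<open>x\<close>. The first is a
  weighted Motzkin-Straus inequality: \<open>p x\<close> is at most the \<open>t\<close>-th power of the sum of
  \<open>root t (c v) * x v\<close> (\<open>clique_motzkin_straus\<close>). Weight can be shifted between vertices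
  that lie in no common \<open>t\<close>-clique until the support is a clique, and there Maclaurin's
  inequality applies. The second is Hoelder's inequality (\<open>holder_power\<close>), which separates
  the weights from \<open>x\<close>.

  If the bound is attained by a maximizer \<open>x\<close>, the equality case of Hoelder's inequality
  makes \<open>x v\<close> proportional to the root of order \<open>t * (t - 1)\<close> of \<open>c v\<close>; in particular \<open>x\<close> is
  positive on all vertices that lie in \<open>t\<close>-cliques. The equality case of the Motzkin-Straus
  inequality, by a second-order perturbation, then shows that lying in no common \<open>t\<close>-clique
  is transitive on these vertices (\<open>motzkin_straus_equality_nonadjacent_trans\<close>). So the
  edges in \<open>t\<close>-cliques form a complete multipartite graph. Its number of classes is the
  clique number, and its number of \<open>t\<close>-cliques is an elementary symmetric polynomial of the
  class sizes (\<open>card_transversals\<close>), so the equality case of Maclaurin's inequality makes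
  the classes equally large (\<open>equality_imp_multipartite\<close>). Conversely, for classes of equal
  size the indicator vector of their union attains the bound (\<open>multipartite_imp_equality\<close>).
\<close>

section \<open>Multilinear polynomials of set families\<close>

definition set_poly :: "'a set set \<Rightarrow> ('a \<Rightarrow> 'b::comm_semiring_1) \<Rightarrow> 'b" where
  "set_poly F x = (\<Sum>K\<in>F. \<Prod>v\<in>K. x v)"

text \<open>The polynomial of the link of \<open>u\<close> is the partial derivative of the polynomial of the
  family with respect to the variable \<open>x u\<close>; the condition \<open>u \<notin> R\<close> makes the link
  free of this variable.\<close>
definition link :: "'a set set \<Rightarrow> 'a \<Rightarrow> 'a set set" where
  "link F u = {R. u \<notin> R \<and> insert u R \<in> F}"

lemma link_subset_Pow: "F \<subseteq> Pow W \<Longrightarrow> link F u \<subseteq> Pow W"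
  by (auto simp: link_def)

lemma set_poly_cong:
  assumes "F \<subseteq> Pow W" "\<And>v. v \<in> W \<Longrightarrow> x v = y v"
  shows "set_poly F x = set_poly F y"
  unfolding set_poly_def using assms by (intro sum.cong prod.cong) auto

lemma set_poly_nonneg:
  fixes x :: "'a \<Rightarrow> real"
  assumes "F \<subseteq> Pow W" "\<And>v. v \<in> W \<Longrightarrow> 0 \<le> x v"
  shows "0 \<le> set_poly F x"
  unfolding set_poly_def using assms by (intro sum_nonneg prod_nonneg) auto

lemma set_poly_cmult:
  assumes "\<And>K. K \<in> F \<Longrightarrow> card K = t"
  shows "set_poly F (\<lambda>v. a * x v) = a ^ t * set_poly F x"
  unfolding set_poly_def using assms by (simp add: prod.distrib sum_distrib_left)

lemma bij_betw_insert_link: "bij_betw (insert u) (link F u) {K \<in> F. u \<in> K}"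
  unfolding bij_betw_def
proof
  show "inj_on (insert u) (link F u)"
    by (auto simp: inj_on_def link_def)
  have "K \<in> insert u ` link F u" if "K \<in> F" "u \<in> K" for K
    using that by (intro image_eqI[of _ _ "K - {u}"]) (auto simp: link_def insert_absorb)
  then show "insert u ` link F u = {K \<in> F. u \<in> K}"
    by (auto simp: link_def)
qed

lemma var_mult_set_poly_link:
  assumes "finite W" "F \<subseteq> Pow W"
  shows "x u * set_poly (link F u) x = set_poly {K \<in> F. u \<in> K} x"
proof -
  have fin: "u \<notin> R" "finite R" if "R \<in> link F u" for R
    using that assms finite_subset[of R W] by (auto simp: link_def)
  have "set_poly {K \<in> F. u \<in> K} x = (\<Sum>R\<in>link F u. \<Prod>v\<in>insert u R. x v)"
    unfolding set_poly_def
    using sum.reindex_bij_betw[OF bij_betw_insert_link, of "\<lambda>K. \<Prod>v\<in>K. x v" u F] by simp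
  also have "\<dots> = (\<Sum>R\<in>link F u. x u * (\<Prod>v\<in>R. x v))"
    using fin by (intro sum.cong) auto
  finally show ?thesis
    by (simp add: set_poly_def sum_distrib_left)
qed

text \<open>The polynomial is affine in each variable, because no variable occurs twice in a monomial.
  All perturbation arguments below rest on this.\<close>
lemma set_poly_split:
  assumes "finite W" "F \<subseteq> Pow W"
  shows "set_poly F x = set_poly {K \<in> F. u \<notin> K} x + x u * set_poly (link F u) x"
proof -
  have "finite F"
    using assms by (meson finite_Pow_iff finite_subset)
  have "set_poly F x = set_poly ({K \<in> F. u \<notin> K} \<union> {K \<in> F. u \<in> K}) x"
    by (rule arg_cong[where f="\<lambda>F. set_poly F x"]) auto
  also have "\<dots> = set_poly {K \<in> F. u \<notin> K} x + set_poly {K \<in> F. u \<in> K} x"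
    unfolding set_poly_def by (rule sum.union_disjoint) (use \<open>finite F\<close> in auto)
  finally show ?thesis
    using var_mult_set_poly_link[OF assms] by metis
qed

lemma set_poly_update:
  fixes x :: "'a \<Rightarrow> 'b::comm_ring_1"
  assumes "finite W" "F \<subseteq> Pow W"
  shows "set_poly F (x(u := s)) = set_poly F x + (s - x u) * set_poly (link F u) x"
proof -
  have "set_poly {K \<in> F. u \<notin> K} (x(u := s)) = set_poly {K \<in> F. u \<notin> K} x"
    "set_poly (link F u) (x(u := s)) = set_poly (link F u) x"
    by (rule set_poly_cong[where W="- {u}"]; auto simp: link_def)+
  then show ?thesis
    using set_poly_split[OF assms, of "x(u := s)" u] set_poly_split[OF assms, of x u]
    by (simp add: algebra_simps)
qed

text \<open>Euler's identity for a homogeneous polynomial of degree \<open>t\<close>.\<close>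
lemma sum_var_mult_set_poly_link:
  fixes x :: "'a \<Rightarrow> 'b::comm_ring_1"
  assumes "finite W" "F \<subseteq> Pow W" "\<And>K. K \<in> F \<Longrightarrow> card K = t"
  shows "(\<Sum>u\<in>W. x u * set_poly (link F u) x) = of_nat t * set_poly F x"
proof -
  have fin: "finite F"
    using assms by (meson finite_Pow_iff finite_subset)
  have "(\<Sum>u\<in>W. x u * set_poly (link F u) x) = (\<Sum>u\<in>W. \<Sum>K | K \<in> F \<and> u \<in> K. \<Prod>v\<in>K. x v)"
    using var_mult_set_poly_link[OF assms(1,2), of x] by (simp add: set_poly_def)
  also have "\<dots> = (\<Sum>K\<in>F. \<Sum>u | u \<in> W \<and> u \<in> K. \<Prod>v\<in>K. x v)"
    using assms(1) fin by (rule sum.swap_restrict)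
  also have "\<dots> = (\<Sum>K\<in>F. of_nat t * (\<Prod>v\<in>K. x v))"
  proof (rule sum.cong)
    fix K assume "K \<in> F"
    then have "{u. u \<in> W \<and> u \<in> K} = K" "card K = t"
      using assms by auto
    then show "(\<Sum>u | u \<in> W \<and> u \<in> K. \<Prod>v\<in>K. x v) = of_nat t * (\<Prod>v\<in>K. x v)"
      by simp
  qed simp
  finally show ?thesis
    by (simp add: set_poly_def sum_distrib_left)
qed

section \<open>Elementary symmetric polynomials and Maclaurin's inequality\<close>

text \<open>The elementary symmetric polynomial of degree \<open>t\<close> in the variables indexed by \<open>S\<close>.\<close>
abbreviation esym :: "nat \<Rightarrow> 'a set \<Rightarrow> ('a \<Rightarrow> 'b::comm_semiring_1) \<Rightarrow> 'b" where
  "esym t S \<equiv> set_poly {K. K \<subseteq> S \<and> card K = t}"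

lemma esym_0:
  assumes "finite S"
  shows "esym 0 S x = 1"
proof -
  have "{K. K \<subseteq> S \<and> card K = 0} = {{}}"
    using assms by (auto dest: finite_subset)
  then show ?thesis
    by (simp add: set_poly_def)
qed

lemma esym_insert:
  assumes "finite S" "i \<notin> S"
  shows "esym (Suc t) (insert i S) x = esym (Suc t) S x + x i * esym t S x"
proof -
  have "{K \<in> {K. K \<subseteq> insert i S \<and> card K = Suc t}. i \<notin> K} = {K. K \<subseteq> S \<and> card K = Suc t}"
    using assms by auto
  moreover have "link {K. K \<subseteq> insert i S \<and> card K = Suc t} i = {K. K \<subseteq> S \<and> card K = t}"
  proof -
    have "card (insert i R) = Suc (card R)" if "R \<subseteq> S" for R
      using that assms by (subst card_insert_disjoint) (auto dest: finite_subset)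
    then show ?thesis
      using assms by (auto simp: link_def subset_insert)
  qed
  ultimately show ?thesis
    using set_poly_split[of "insert i S" "{K. K \<subseteq> insert i S \<and> card K = Suc t}" x i] assms
    by auto
qed

lemma esym_const:
  assumes "finite S"
  shows "esym t S (\<lambda>_. m) = of_nat (card S choose t) * m ^ t"
proof -
  have "esym t S (\<lambda>_. m) = (\<Sum>K | K \<subseteq> S \<and> card K = t. m ^ t)"
    unfolding set_poly_def by (rule sum.cong) auto
  then show ?thesis
    using n_subsets[OF assms, of t] by simp
qed

text \<open>As a function of two of its variables, an elementary symmetric polynomial depends only on
  their sum and their product; so with the sum kept it is affine in the product.\<close>
lemma esym_change_two:
  fixes y :: "'a \<Rightarrow> 'b::comm_ring_1"
  assumes "finite S" "i \<in> S" "j \<in> S" "i \<noteq> j" "p + q = y i + y j"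
  shows "esym (Suc (Suc t)) S (y(i := p, j := q))
       = esym (Suc (Suc t)) S y + (p * q - y i * y j) * esym t (S - {i, j}) y"
proof -
  define S' where "S' = S - {i, j}"
  have S: "S = insert i (insert j S')" and fin: "finite S'" "i \<notin> insert j S'" "j \<notin> S'"
    using assms by (auto simp: S'_def)
  have expand: "esym (Suc (Suc t)) S z = esym (Suc (Suc t)) S' z
      + (z i + z j) * esym (Suc t) S' z + z i * z j * esym t S' z" for z :: "'a \<Rightarrow> 'b"
    unfolding S using fin by (simp add: esym_insert algebra_simps)
  have "esym k S' (y(i := p, j := q)) = esym k S' y" for k
    by (rule set_poly_cong[where W=S']) (use fin in auto)
  moreover have "(y(i := p, j := q)) i = p" "(y(i := p, j := q)) j = q"
    using assms by auto
  ultimately have "esym (Suc (Suc t)) S (y(i := p, j := q)) = esym (Suc (Suc t)) S' y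
      + (y i + y j) * esym (Suc t) S' y + p * q * esym t S' y"
    by (simp only: expand assms(5))
  then show ?thesis
    unfolding S'_def[symmetric] by (simp add: expand algebra_simps)
qed

lemma sum_change_two:
  fixes y :: "'a \<Rightarrow> 'b::comm_monoid_add"
  assumes "finite S" "i \<in> S" "j \<in> S" "i \<noteq> j" "p + q = y i + y j"
  shows "sum (y(i := p, j := q)) S = sum y S"
proof -
  have split: "sum z S = (z i + z j) + sum z (S - {i} - {j})" for z :: "'a \<Rightarrow> 'b"
    using sum.remove[OF assms(1,2), of z] sum.remove[of "S - {i}" j z] assms
    by (simp add: add.assoc)
  have "sum (y(i := p, j := q)) (S - {i} - {j}) = sum y (S - {i} - {j})"
    by (rule sum.cong) auto
  then show ?thesis
    unfolding split[of y] split[of "y(i := p, j := q)"] using assms(4,5) by simp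
qed

text \<open>Smoothing: raising an entry below the mean \<open>m\<close> to the value \<open>m\<close>, at the cost of an entry
  above the mean, does not decrease the product of the two, hence does not decrease the
  polynomial, and it lowers the number of entries that differ from \<open>m\<close>.\<close>
lemma maclaurin_inequality:
  fixes y :: "'a \<Rightarrow> real"
  assumes "finite S" "\<And>i. i \<in> S \<Longrightarrow> 0 \<le> y i" "sum y S = m * real (card S)" "2 \<le> t"
  shows "esym t S y \<le> real (card S choose t) * m ^ t"
  using assms(2,3)
proof (induction "card {i \<in> S. y i \<noteq> m}" arbitrary: y rule: less_induct)
  case (less y)
  define r where "r = t - 2"
  have t: "t = Suc (Suc r)"
    using assms(4) by (simp add: r_def)
  have diff0: "(\<Sum>i\<in>S. y i - m) = 0"
    using less.prems(2) by (simp add: sum_subtractf)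
  show ?case
  proof (cases "\<forall>i\<in>S. y i = m")
    case True
    then have "esym t S y = esym t S (\<lambda>_. m)"
      by (intro set_poly_cong[where W=S]) auto
    then show ?thesis
      using esym_const[OF assms(1), of t m] by simp
  next
    case False
    \<comment> \<open>Some entry lies below the mean and some entry lies above it; the smaller one is raised
      to the mean while the sum is kept.\<close>
    obtain i where i: "i \<in> S" "y i < m"
    proof (rule ccontr)
      assume "\<not> thesis"
      with that have "\<forall>i\<in>S. 0 \<le> y i - m"
        by force
      with diff0 have "\<forall>i\<in>S. y i - m = 0"
        using sum_nonneg_eq_0_iff[OF assms(1), of "\<lambda>i. y i - m"] by auto
      with False show False
        by auto
    qed
    obtain j where j: "j \<in> S" "m < y j"
    proof (rule ccontr)
      assume "\<not> thesis"
      with that have *: "\<forall>i\<in>S. y i - m \<le> 0"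
        by force
      have "(\<Sum>i\<in>S. y i - m) < (\<Sum>i\<in>S. 0)"
        by (rule sum_strict_mono_ex1) (use assms(1) * i in auto)
      with diff0 show False
        by simp
    qed
    define z where "z = y(i := m, j := y i + y j - m)"
    have ij: "i \<noteq> j"
      using i j by auto
    have "0 \<le> m"
      using less.prems(1)[OF i(1)] i(2) by simp
    have z0: "0 \<le> z k" if "k \<in> S" for k
      using less.prems(1)[OF that] less.prems(1)[OF i(1)] i j \<open>0 \<le> m\<close> by (auto simp: z_def)
    have zsum: "sum z S = m * real (card S)"
      using sum_change_two[OF assms(1) i(1) j(1) ij, of m "y i + y j - m" y] less.prems(2)
      by (simp add: z_def)
    have "z i = m"
      using ij by (simp add: z_def)
    have "{k \<in> S. z k \<noteq> m} \<subseteq> {k \<in> S. y k \<noteq> m} - {i}"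
    proof (rule subsetI)
      fix k assume "k \<in> {k \<in> S. z k \<noteq> m}"
      then show "k \<in> {k \<in> S. y k \<noteq> m} - {i}"
        using \<open>z i = m\<close> j by (cases "k = j") (auto simp: z_def)
    qed
    then have "card {k \<in> S. z k \<noteq> m} \<le> card ({k \<in> S. y k \<noteq> m} - {i})"
      using assms(1) by (intro card_mono) simp_all
    also have "\<dots> < card {k \<in> S. y k \<noteq> m}"
      by (rule card_Diff1_less) (use assms(1) i in simp_all)
    finally have "card {k \<in> S. z k \<noteq> m} < card {k \<in> S. y k \<noteq> m}" .
    then have IH: "esym t S z \<le> real (card S choose t) * m ^ t"
      using less.hyps[OF _ z0 zsum] by simp
    have "m * (y i + y j - m) - y i * y j = (m - y i) * (y j - m)"
      by (simp add: algebra_simps)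
    moreover have "0 \<le> (m - y i) * (y j - m)"
      using i j by simp
    moreover have "0 \<le> esym r (S - {i, j}) y"
      by (rule set_poly_nonneg[where W=S]) (use less.prems in auto)
    ultimately have "esym t S y \<le> esym t S z"
      using esym_change_two[OF assms(1) i(1) j(1) ij, of m "y i + y j - m" y r]
      unfolding z_def t by simp
    with IH show ?thesis
      by linarith
  qed
qed

text \<open>Two different entries could be replaced by their average, which raises the polynomial
  strictly when the other entries are positive, in contradiction to the inequality for the
  new point.\<close>
lemma maclaurin_equality:
  fixes y :: "'a \<Rightarrow> real"
  assumes "finite S" "\<And>i. i \<in> S \<Longrightarrow> 0 < y i" "sum y S = m * real (card S)"
    and "2 \<le> t" "t \<le> card S" "esym t S y = real (card S choose t) * m ^ t"
    and ij: "i \<in> S" "j \<in> S"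
  shows "y i = y j"
proof (rule ccontr)
  assume neq: "y i \<noteq> y j"
  then have "i \<noteq> j"
    by auto
  define r where "r = t - 2"
  have t: "t = Suc (Suc r)"
    using assms(4) by (simp add: r_def)
  define q where "q = (y i + y j) / 2"
  define z where "z = y(i := q, j := q)"
  have q: "q + q = y i + y j" "0 < q"
    using assms(2)[OF ij(1)] assms(2)[OF ij(2)] by (auto simp: q_def)
  have "q * q - y i * y j = ((y i - y j) / 2)\<^sup>2"
    by (simp add: q_def power2_eq_square field_simps)
  then have "0 < q * q - y i * y j"
    using neq by simp
  moreover have "0 < esym r (S - {i, j}) y"
  proof -
    have "r \<le> card (S - {i, j})"
      using assms(5) ij \<open>i \<noteq> j\<close> by (simp add: card_Diff_subset t)
    then obtain K where "K \<subseteq> S - {i, j}" "card K = r"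
      by (meson obtain_subset_with_card_n)
    then show ?thesis
      unfolding set_poly_def using assms(1,2) by (intro sum_pos prod_pos) auto
  qed
  ultimately have "0 < (q * q - y i * y j) * esym r (S - {i, j}) y"
    by simp
  then have "esym t S y < esym t S z"
    using esym_change_two[OF assms(1) ij \<open>i \<noteq> j\<close> q(1), of r] unfolding t z_def by linarith
  moreover have "esym t S z \<le> real (card S choose t) * m ^ t"
  proof (rule maclaurin_inequality[OF assms(1)])
    show "0 \<le> z k" if "k \<in> S" for k
      using assms(2)[OF that] q by (auto simp: z_def)
    show "sum z S = m * real (card S)"
      using sum_change_two[OF assms(1) ij \<open>i \<noteq> j\<close> q(1)] assms(3) by (simp add: z_def)
  qed (rule assms(4))
  ultimately show False
    using assms(6) by simp
qed

section \<open>Hoelder's inequality\<close>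

text \<open>The power function lies above its tangent at \<open>y\<close>; summing such tangents linearizes the sum
  of powers in Hoelder's inequality, whose equality case then holds term by term.\<close>
lemma power_tangent:
  fixes x y :: real
  assumes "0 \<le> x" "0 \<le> y"
  shows "y ^ t + real t * y ^ (t - 1) * (x - y) \<le> x ^ t"
proof (induction t)
  case (Suc t)
  have "x * (y ^ t + real t * y ^ (t - 1) * (x - y)) \<le> x * x ^ t"
    using Suc assms by (intro mult_left_mono)
  moreover have "x * (y ^ t + real t * y ^ (t - 1) * (x - y))
      = y ^ Suc t + real (Suc t) * y ^ t * (x - y) + real t * y ^ (t - 1) * (x - y)\<^sup>2"
    by (cases t) (simp_all add: algebra_simps power2_eq_square)
  moreover have "0 \<le> real t * y ^ (t - 1) * (x - y)\<^sup>2"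
    using assms by simp
  ultimately show ?case
    unfolding diff_Suc_1 power_Suc[of x t] by linarith
qed simp

lemma power_tangent_eq:
  fixes x y :: real
  assumes "0 \<le> x" "0 \<le> y" "2 \<le> t" "x ^ t = y ^ t + real t * y ^ (t - 1) * (x - y)"
  shows "x = y"
proof (rule ccontr)
  assume neq: "x \<noteq> y"
  define r where "r = t - 2"
  have t: "t = Suc (Suc r)"
    using assms(3) by (simp add: r_def)
  show False
  proof (cases "y = 0")
    case True
    then show False
      using assms(4) neq t by simp
  next
    case False
    have "x * (y ^ Suc r + real (Suc r) * y ^ r * (x - y)) \<le> x * x ^ Suc r"
      using power_tangent[OF assms(1,2), of "Suc r"] assms(1) by (intro mult_left_mono) auto
    moreover have "x * (y ^ Suc r + real (Suc r) * y ^ r * (x - y))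
      = y ^ t + real t * y ^ (t - 1) * (x - y) + real (Suc r) * y ^ r * (x - y)\<^sup>2"
      by (simp add: t algebra_simps power2_eq_square)
    moreover have "0 < real (Suc r) * y ^ r * (x - y)\<^sup>2"
      using assms(2) False neq by (intro mult_pos_pos) auto
    moreover have "x * x ^ Suc r = x ^ t"
      by (simp add: t)
    ultimately show False
      using assms(4) by linarith
  qed
qed

text \<open>Hoelder's inequality for the exponents \<open>t / (t - 1)\<close> and \<open>t\<close>, with the first vector
  written as \<open>h v ^ (t - 1)\<close> so that no fractional power occurs, together with the
  proportionality that equality forces. It is the sum of the tangent inequalities at the
  points \<open>m * h v\<close>, where \<open>m\<close> is chosen such that the linear terms cancel.\<close>
lemma holder_power:
  fixes h x :: "'a \<Rightarrow> real"
  assumes "finite V" "\<And>v. v \<in> V \<Longrightarrow> 0 \<le> h v" "\<And>v. v \<in> V \<Longrightarrow> 0 \<le> x v" "2 \<le> t"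
    and H: "0 < (\<Sum>v\<in>V. h v ^ t)"
  shows "(\<Sum>v\<in>V. h v ^ (t - 1) * x v) ^ t \<le> (\<Sum>v\<in>V. h v ^ t) ^ (t - 1) * (\<Sum>v\<in>V. x v ^ t)" (is ?ineq)
    and "(\<Sum>v\<in>V. h v ^ (t - 1) * x v) ^ t = (\<Sum>v\<in>V. h v ^ t) ^ (t - 1) * (\<Sum>v\<in>V. x v ^ t)
      \<Longrightarrow> v \<in> V \<Longrightarrow> x v = (\<Sum>v\<in>V. h v ^ (t - 1) * x v) / (\<Sum>v\<in>V. h v ^ t) * h v"
proof -
  define L where "L = (\<Sum>v\<in>V. h v ^ (t - 1) * x v)"
  define H where "H = (\<Sum>v\<in>V. h v ^ t)"
  define m where "m = L / H"
  have "0 < H" "L = m * H"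
    using H by (simp_all add: H_def m_def)
  have "0 \<le> L"
    unfolding L_def using assms by (intro sum_nonneg) auto
  then have "0 \<le> m"
    using \<open>0 < H\<close> by (simp add: m_def)
  define r where "r = t - 1"
  have t: "t = Suc r"
    using assms(4) by (simp add: r_def)
  \<comment> \<open>The tangent to the power function at the point where equality would hold.\<close>
  define T where "T v = (m * h v) ^ t + real t * (m * h v) ^ (t - 1) * (x v - m * h v)" for v
  have T: "T v \<le> x v ^ t" if "v \<in> V" for v
    unfolding T_def using assms(2,3)[OF that] \<open>0 \<le> m\<close> by (intro power_tangent) auto
  have "T v = m ^ t * h v ^ t + real t * m ^ (t - 1) * (h v ^ (t - 1) * x v - m * h v ^ t)" for v
    by (simp add: T_def t algebra_simps power_mult_distrib)
  then have "sum T V = m ^ t * H + real t * m ^ (t - 1) * (L - m * H)"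
    by (simp add: sum.distrib sum_subtractf sum_distrib_left[symmetric] H_def L_def)
  then have sumT: "sum T V = m ^ t * H"
    using \<open>L = m * H\<close> by simp
  have L: "L ^ t = H ^ (t - 1) * sum T V"
    unfolding sumT \<open>L = m * H\<close> t by (simp add: power_mult_distrib algebra_simps)
  show ?ineq
    unfolding L_def[symmetric] H_def[symmetric] L
    using \<open>0 < H\<close> T by (intro mult_left_mono sum_mono) auto
  show "x v = (\<Sum>v\<in>V. h v ^ (t - 1) * x v) / (\<Sum>v\<in>V. h v ^ t) * h v"
    if eq: "(\<Sum>v\<in>V. h v ^ (t - 1) * x v) ^ t = (\<Sum>v\<in>V. h v ^ t) ^ (t - 1) * (\<Sum>v\<in>V. x v ^ t)"
      and v: "v \<in> V"
  proof -
    have "H ^ (t - 1) * sum T V = H ^ (t - 1) * (\<Sum>v\<in>V. x v ^ t)"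
      using eq unfolding L_def[symmetric] H_def[symmetric] L .
    then have "(\<Sum>v\<in>V. x v ^ t - T v) = 0"
      using \<open>0 < H\<close> by (simp add: sum_subtractf)
    moreover have "\<forall>v\<in>V. 0 \<le> x v ^ t - T v"
      using T by simp
    ultimately have "x v ^ t - T v = 0"
      using v sum_nonneg_eq_0_iff[OF assms(1), of "\<lambda>v. x v ^ t - T v"] by auto
    then have "x v = m * h v"
      using power_tangent_eq[of "x v" "m * h v" t] assms(2,3)[OF v] \<open>0 \<le> m\<close> assms(4)
      by (simp add: T_def)
    then show ?thesis
      by (simp add: m_def L_def H_def)
  qed
qed

section \<open>The weighted Motzkin-Straus inequality\<close>

lemma link_link_empty:
  assumes "\<And>K. K \<in> F \<Longrightarrow> u \<in> K \<Longrightarrow> v \<notin> K"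
  shows "link (link F u) v = {}"
  using assms by (auto simp: link_def)

text \<open>Moving weight between two vertices in no common member of the family produces no mixed
  term, so the polynomial is affine along such a move.\<close>
lemma set_poly_update_two:
  fixes x :: "'a \<Rightarrow> 'b::comm_ring_1"
  assumes "finite W" "F \<subseteq> Pow W" "u \<noteq> v" and "\<And>K. K \<in> F \<Longrightarrow> u \<in> K \<Longrightarrow> v \<notin> K"
  shows "set_poly F (x(u := s, v := r)) = set_poly F x
       + (s - x u) * set_poly (link F u) x + (r - x v) * set_poly (link F v) x"
proof -
  have "link (link F v) u = {}"
    using assms(4) by (intro link_link_empty) auto
  then have "set_poly (link F v) (x(u := s)) = set_poly (link F v) x"
    using set_poly_update[OF assms(1) link_subset_Pow[OF assms(2)], of v x u s]
    by (simp add: set_poly_def)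
  then show ?thesis
    using set_poly_update[OF assms(1,2), of "x(u := s)" v r]
      set_poly_update[OF assms(1,2), of x u s] assms(3) by simp
qed

lemma sum_mult_change_two:
  fixes g x :: "'a \<Rightarrow> real"
  assumes "finite W" "u \<in> W" "v \<in> W" "u \<noteq> v" "g u * p + g v * q = g u * x u + g v * x v"
  shows "(\<Sum>w\<in>W. g w * (x(u := p, v := q)) w) = (\<Sum>w\<in>W. g w * x w)"
proof -
  have "(\<lambda>w. g w * (x(u := p, v := q)) w) = (\<lambda>w. g w * x w)(u := g u * p, v := g v * q)"
    using assms(4) by (auto simp: fun_eq_iff)
  then have "(\<Sum>w\<in>W. g w * (x(u := p, v := q)) w)
      = sum ((\<lambda>w. g w * x w)(u := g u * p, v := g v * q)) W"
    by (simp only:)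
  also have "\<dots> = (\<Sum>w\<in>W. g w * x w)"
    by (rule sum_change_two) (use assms in simp_all)
  finally show ?thesis .
qed

text \<open>The Motzkin-Straus argument, with weights. If two vertices of the support lie in no common
  member of the family, weight can be shifted from one to the other such that the right-hand
  side is kept. The left-hand side is affine along the shift, so in one of the two
  directions it does not decrease until a vertex has left the support. Hence only supports
  in which any two vertices lie in a common member matter; for them the inequality is a
  hypothesis.\<close>
lemma weighted_motzkin_straus:
  fixes g x :: "'a \<Rightarrow> real"
  assumes W: "finite W" and F: "F \<subseteq> Pow W"
    and g: "\<And>v. v \<in> W \<Longrightarrow> 0 < g v"
    and clique: "\<And>S y. S \<subseteq> W \<Longrightarrow> (\<And>u v. u \<in> S \<Longrightarrow> v \<in> S \<Longrightarrow> u \<noteq> v \<Longrightarrow> \<exists>K\<in>F. u \<in> K \<and> v \<in> K)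
        \<Longrightarrow> (\<And>v. v \<in> W \<Longrightarrow> 0 \<le> y v) \<Longrightarrow> (\<And>v. v \<in> W - S \<Longrightarrow> y v = 0)
        \<Longrightarrow> set_poly F y \<le> (\<Sum>v\<in>W. g v * y v) ^ t"
    and x: "\<And>v. v \<in> W \<Longrightarrow> 0 \<le> x v"
  shows "set_poly F x \<le> (\<Sum>v\<in>W. g v * x v) ^ t"
  using x
proof (induction "card {v \<in> W. x v \<noteq> 0}" arbitrary: x rule: less_induct)
  case (less x)
  define S where "S = {v \<in> W. x v \<noteq> 0}"
  have shift: ?case if uv: "u \<in> S" "v \<in> S" "u \<noteq> v" and indep: "\<And>K. K \<in> F \<Longrightarrow> u \<in> K \<Longrightarrow> v \<notin> K"
    and slope: "set_poly (link F v) x / g v \<le> set_poly (link F u) x / g u" for u v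
  proof -
    have pos: "u \<in> W" "v \<in> W" "0 < g u" "0 < g v" "0 \<le> x u" "0 \<le> x v"
      using uv g less.prems by (auto simp: S_def)
    \<comment> \<open>All weight of v is moved to u.\<close>
    define p where "p = x u + g v * x v / g u"
    define y where "y = x(u := p, v := 0)"
    have "0 \<le> p"
      using pos by (simp add: p_def)
    have y: "0 \<le> y w" if "w \<in> W" for w
      using less.prems[OF that] \<open>0 \<le> p\<close> by (simp add: y_def)
    have "{w \<in> W. y w \<noteq> 0} \<subseteq> S - {v}"
    proof (rule subsetI)
      fix w assume "w \<in> {w \<in> W. y w \<noteq> 0}"
      then show "w \<in> S - {v}"
        using uv(1) by (cases "w = u"; cases "w = v") (simp_all add: y_def S_def)
    qed
    then have "card {w \<in> W. y w \<noteq> 0} \<le> card (S - {v})"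
      using W by (intro card_mono) (simp_all add: S_def)
    also have "\<dots> < card S"
      by (rule card_Diff1_less) (use W uv in \<open>simp_all add: S_def\<close>)
    finally have "set_poly F y \<le> (\<Sum>w\<in>W. g w * y w) ^ t"
      unfolding S_def by (rule less.hyps) (rule y)
    moreover have "(\<Sum>w\<in>W. g w * y w) = (\<Sum>w\<in>W. g w * x w)"
      unfolding y_def using pos uv(3) W
      by (intro sum_mult_change_two) (simp_all add: p_def field_simps)
    moreover have "set_poly F x \<le> set_poly F y"
    proof -
      have "set_poly F y = set_poly F x
          + g v * x v * (set_poly (link F u) x / g u - set_poly (link F v) x / g v)"
      proof -
        have "p - x u = g v * x v / g u"
          by (simp add: p_def)
        moreover have "set_poly F y = set_poly F x
            + (p - x u) * set_poly (link F u) x + (0 - x v) * set_poly (link F v) x"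
          unfolding y_def by (rule set_poly_update_two[OF W F uv(3) indep])
        ultimately show ?thesis
          using pos by (simp add: right_diff_distrib)
      qed
      moreover have "0 \<le> g v * x v * (set_poly (link F u) x / g u - set_poly (link F v) x / g v)"
        using pos slope by simp
      ultimately show ?thesis
        by linarith
    qed
    ultimately show ?thesis
      by simp
  qed
  show ?case
  proof (cases "\<forall>u\<in>S. \<forall>v\<in>S. u \<noteq> v \<longrightarrow> (\<exists>K\<in>F. u \<in> K \<and> v \<in> K)")
    case True
    then show ?thesis
      using less.prems by (intro clique[of S]) (auto simp: S_def)
  next
    case False
    then obtain u v where uv: "u \<in> S" "v \<in> S" "u \<noteq> v" "\<And>K. K \<in> F \<Longrightarrow> u \<in> K \<Longrightarrow> v \<notin> K"
      by blast
    show ?thesis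
    proof (cases "set_poly (link F v) x / g v \<le> set_poly (link F u) x / g u")
      case True
      then show ?thesis
        using shift[of u v] uv by blast
    next
      case False
      then show ?thesis
        using shift[of v u] uv by (metis linorder_le_cases)
    qed
  qed
qed

text \<open>At a point of equality with full support, the polynomial is maximal among all points with
  the same weighted sum. If \<open>u, v\<close> and \<open>v, w\<close> are two pairs without a common member, then
  moving weight (measured by \<open>g\<close>) from \<open>v\<close> to \<open>u\<close> and \<open>w\<close> in equal parts changes the
  polynomial, by the first-order conditions, only through the mixed term of \<open>u\<close> and \<open>w\<close>.
  This term is positive as soon as \<open>u\<close> and \<open>w\<close> have a common member, which would contradict
  maximality.\<close>
lemma motzkin_straus_equality_nonadjacent_trans:
  fixes g x :: "'a \<Rightarrow> real"
  assumes W: "finite W" and F: "F \<subseteq> Pow W"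
    and g: "\<And>v. v \<in> W \<Longrightarrow> 0 < g v"
    and bound: "\<And>y. (\<And>v. v \<in> W \<Longrightarrow> 0 \<le> y v) \<Longrightarrow> set_poly F y \<le> (\<Sum>v\<in>W. g v * y v) ^ t"
    and x: "\<And>v. v \<in> W \<Longrightarrow> 0 < x v" and eq: "set_poly F x = (\<Sum>v\<in>W. g v * x v) ^ t"
    and uvw: "u \<in> W" "v \<in> W" "w \<in> W" "u \<noteq> v" "v \<noteq> w" "u \<noteq> w"
    and uv: "\<And>K. K \<in> F \<Longrightarrow> u \<in> K \<Longrightarrow> v \<notin> K"
    and vw: "\<And>K. K \<in> F \<Longrightarrow> v \<in> K \<Longrightarrow> w \<notin> K"
    and K: "K \<in> F" "u \<in> K"
  shows "w \<notin> K"
proof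
  assume "w \<in> K"
  have pos: "0 < g u" "0 < g v" "0 < g w" "0 < x u" "0 < x v" "0 < x w"
    using g x uvw by auto
  define A where "A = set_poly (link F u) x / g u"
  define B where "B = set_poly (link F v) x / g v"
  define C where "C = set_poly (link F w) x / g w"
  define M where "M = set_poly (link (link F w) u) x / (g u * g w)"
  \<comment> \<open>No member of the family contains v together with u or w, so the only mixed
    second-order term belongs to the pair u, w.\<close>
  have move: "a * A + b * B + c * C + a * c * M \<le> 0"
    if abc: "a + b + c = 0" "- (g u * x u) \<le> a" "- (g v * x v) \<le> b" "- (g w * x w) \<le> c" for a b c
  proof -
    define z where "z = x(u := x u + a / g u, v := x v + b / g v)"
    define y where "y = z(w := x w + c / g w)"
    have "0 \<le> x u + a / g u" "0 \<le> x v + b / g v" "0 \<le> x w + c / g w"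
      using abc pos by (auto simp: field_simps)
    then have "0 \<le> y k" if "k \<in> W" for k
      using x[OF that] by (simp add: y_def z_def)
    then have "set_poly F y \<le> (\<Sum>k\<in>W. g k * y k) ^ t"
      by (rule bound)
    also have "(\<Sum>k\<in>W. g k * y k) = (\<Sum>k\<in>W. g k * x k)"
    proof -
      have "g k * y k = g k * x k + ((if k = u then a else 0) + ((if k = v then b else 0)
          + (if k = w then c else 0)))" for k
        using uvw pos by (simp add: y_def z_def field_simps)
      then have "(\<Sum>k\<in>W. g k * y k) = (\<Sum>k\<in>W. g k * x k) + (a + (b + c))"
        using W uvw by (simp add: sum.distrib)
      then show ?thesis
        using abc by simp
    qed
    finally have "set_poly F y \<le> set_poly F x"
      using eq by simp
    moreover have "set_poly F y = set_poly F x + (a * A + b * B + c * C + a * c * M)"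
    proof -
      have "set_poly F y = set_poly F z + (x w + c / g w - z w) * set_poly (link F w) z"
        unfolding y_def by (rule set_poly_update[OF W F])
      also have "set_poly F z = set_poly F x + a / g u * set_poly (link F u) x
          + b / g v * set_poly (link F v) x"
        unfolding z_def
        using set_poly_update_two[OF W F uvw(4) uv, of x "x u + a / g u" "x v + b / g v"] by simp
      also have "set_poly (link F w) z = set_poly (link F w) x
          + a / g u * set_poly (link (link F w) u) x + b / g v * set_poly (link (link F w) v) x"
        unfolding z_def
        using set_poly_update_two[OF W link_subset_Pow[OF F] uvw(4), of w x "x u + a / g u" "x v + b / g v"] uv
        by (auto simp: link_def)
      also have "link (link F w) v = {}"
        by (rule link_link_empty) (use vw in auto)
      also have "z w = x w"
        using uvw by (simp add: z_def)
      finally show ?thesis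
        using pos by (simp add: set_poly_def[of "{}"] A_def B_def C_def M_def distrib_left mult_ac)
    qed
    ultimately show ?thesis
      by linarith
  qed
  \<comment> \<open>So small that the vertex v can give up twice this amount.\<close>
  define e where "e = Min {g u * x u, g v * x v, g w * x w} / 2"
  have e: "0 < e" "2 * e \<le> g u * x u" "2 * e \<le> g v * x v" "2 * e \<le> g w * x w"
    using pos by (auto simp: e_def)
  \<comment> \<open>A move between two of the vertices is possible in both senses, so its slope vanishes.\<close>
  have "e * A = e * B"
    using move[of e "- e" 0] move[of "- e" e 0] e by simp
  moreover have "e * B = e * C"
    using move[of 0 e "- e"] move[of 0 "- e" e] e by simp
  \<comment> \<open>Along this direction the first-order terms cancel.\<close>
  ultimately have "e * e * M \<le> 0"
    using move[of e "- 2 * e" e] e by simp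
  then have "set_poly (link (link F w) u) x \<le> 0"
    using e pos by (simp add: M_def mult_le_0_iff divide_le_0_iff)
  moreover have "0 < set_poly (link (link F w) u) x"
    unfolding set_poly_def
  proof (rule sum_pos)
    show "finite (link (link F w) u)"
      using W F link_subset_Pow by (meson finite_Pow_iff finite_subset)
    have "insert w (insert u (K - {u, w})) = K"
      using K \<open>w \<in> K\<close> by auto
    then have "K - {u, w} \<in> link (link F w) u"
      using K uvw by (auto simp: link_def)
    then show "link (link F w) u \<noteq> {}"
      by auto
    show "0 < (\<Prod>k\<in>R. x k)" if "R \<in> link (link F w) u" for R
      using that F x by (intro prod_pos) (auto simp: link_def)
  qed
  ultimately show False
    by simp
qed

section \<open>The spectral radius as a maximum of the clique polynomial\<close>

lemma compact_box_fun:
  fixes B :: "'a \<Rightarrow> real set"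
  assumes "\<And>v. compact (B v)"
  shows "compact {x. \<forall>v. x v \<in> B v}"
proof -
  have "{x. \<forall>v. x v \<in> B v} = PiE UNIV B"
    by (auto simp: PiE_def Pi_def extensional_def)
  moreover have "compactin (product_topology (\<lambda>_. euclidean) UNIV) (PiE UNIV B)"
    using assms by (simp add: compactin_PiE)
  ultimately show ?thesis
    by (simp add: euclidean_product_topology)
qed

text \<open>A maximum over the compact set of nonnegative vectors with \<open>t\<close>-th powers summing to 1,
  where the coordinates outside \<open>V\<close> are set to 0. Homogeneity extends the bound to all
  nonnegative vectors.\<close>
lemma set_poly_maximizer:
  fixes F :: "'a set set"
  assumes V: "finite V" "V \<noteq> {}" and F: "F \<subseteq> Pow V" and card: "\<And>K. K \<in> F \<Longrightarrow> card K = t"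
    and t: "1 \<le> t"
  obtains x :: "'a \<Rightarrow> real" where "\<And>v. 0 \<le> x v" "(\<Sum>v\<in>V. x v ^ t) = 1"
    "\<And>y. (\<And>v. v \<in> V \<Longrightarrow> 0 \<le> y v) \<Longrightarrow> set_poly F y \<le> set_poly F x * (\<Sum>v\<in>V. y v ^ t)"
proof -
  define B where "B v = (if v \<in> V then {0..1} else {0::real})" for v
  define S where "S = {x. \<forall>v. x v \<in> B v} \<inter> {x. (\<Sum>v\<in>V. x v ^ t) = 1}"
  have "compact {x. \<forall>v. x v \<in> B v}"
    by (rule compact_box_fun) (simp add: B_def)
  moreover have "closed {x :: 'a \<Rightarrow> real. (\<Sum>v\<in>V. x v ^ t) = 1}"
    by (intro closed_Collect_eq continuous_intros continuous_on_product_coordinates)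
  ultimately have "compact S"
    unfolding S_def by (rule compact_Int_closed)
  moreover have "S \<noteq> {}"
  proof -
    obtain v0 where "v0 \<in> V"
      using V by auto
    define z where "z v = (if v = v0 then 1 else 0 :: real)" for v
    have "z v ^ t = (if v = v0 then 1 else 0)" for v
      using t by (simp add: z_def)
    then have "(\<Sum>v\<in>V. z v ^ t) = 1"
      using V \<open>v0 \<in> V\<close> by simp
    then have "z \<in> S"
      using \<open>v0 \<in> V\<close> by (auto simp: S_def B_def z_def)
    then show ?thesis
      by auto
  qed
  moreover have "continuous_on S (set_poly F)"
    unfolding set_poly_def
    by (intro continuous_intros continuous_on_subset[OF continuous_on_product_coordinates]) auto
  ultimately obtain x where x: "x \<in> S" and max: "\<And>y. y \<in> S \<Longrightarrow> set_poly F y \<le> set_poly F x"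
    using continuous_attains_sup by metis
  show ?thesis
  proof
    show "0 \<le> x v" for v
      using x by (auto simp: S_def B_def split: if_splits dest: spec[of _ v])
    show "(\<Sum>v\<in>V. x v ^ t) = 1"
      using x by (simp add: S_def)
    fix y :: "'a \<Rightarrow> real" assume y: "\<And>v. v \<in> V \<Longrightarrow> 0 \<le> y v"
    define N where "N = (\<Sum>v\<in>V. y v ^ t)"
    have N0: "y v ^ t \<le> N" if "v \<in> V" for v
      unfolding N_def using V y that by (intro member_le_sum) auto
    have "0 \<le> N"
      unfolding N_def using y by (intro sum_nonneg) auto
    show "set_poly F y \<le> set_poly F x * N"
    proof (cases "N = 0")
      case True
      have "y v = 0" if "v \<in> V" for v
        using N0[OF that] y[OF that] True zero_less_power[of "y v" t] by linarith
      then have "set_poly F y = set_poly F (\<lambda>v. 0 * y v)"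
        by (intro set_poly_cong[OF F]) simp
      also have "\<dots> = 0 ^ t * set_poly F y"
        by (rule set_poly_cmult) (rule card)
      also have "\<dots> = 0"
        using t by simp
      finally show ?thesis
        using True by simp
    next
      case False
      define r where "r = root t N"
      have r: "0 < r" "r ^ t = N"
        using False \<open>0 \<le> N\<close> t by (auto simp: r_def)
      define z where "z v = (if v \<in> V then y v / r else 0)" for v
      have "(\<Sum>v\<in>V. z v ^ t) = 1"
        using r False by (simp add: z_def power_divide sum_divide_distrib[symmetric] N_def[symmetric])
      moreover have "y v \<le> r" if "v \<in> V" for v
        using N0[OF that] r t y[OF that] power_mono_iff[of "y v" r t] by simp
      then have "z v \<in> B v" for v
        using y[of v] r by (simp add: z_def B_def)
      ultimately have "set_poly F z \<le> set_poly F x"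
        by (intro max) (simp add: S_def)
      moreover have "set_poly F y = set_poly F (\<lambda>v. r * z v)"
        by (intro set_poly_cong[OF F]) (use r in \<open>simp add: z_def\<close>)
      ultimately show ?thesis
        using set_poly_cmult[OF card, of F r z] r \<open>0 \<le> N\<close>
        by (simp add: mult.commute[of _ N] mult_left_mono)
    qed
  qed
qed

text \<open>The Lagrange condition at the maximizer. Where \<open>x i\<close> is positive, the derivative of a
  function of one variable vanishes at an interior maximum. Where \<open>x i = 0\<close>, only a
  one-sided condition is available, which says that the partial derivative is at most 0; it
  is also at least 0 because all coefficients and coordinates are nonnegative.\<close>
lemma set_poly_maximizer_stationary:
  fixes x :: "'a \<Rightarrow> real"
  assumes V: "finite V" and F: "F \<subseteq> Pow V" and t: "2 \<le> t"
    and x: "\<And>v. 0 \<le> x v" "(\<Sum>v\<in>V. x v ^ t) = 1"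
    and max: "\<And>y. (\<And>v. v \<in> V \<Longrightarrow> 0 \<le> y v) \<Longrightarrow> set_poly F y \<le> set_poly F x * (\<Sum>v\<in>V. y v ^ t)"
    and i: "i \<in> V"
  shows "set_poly (link F i) x = real t * set_poly F x * x i ^ (t - 1)"
proof -
  define m where "m = set_poly F x"
  define D where "D = set_poly (link F i) x"
  have "0 \<le> m" "0 \<le> D"
    unfolding m_def D_def using x(1) by (auto intro: set_poly_nonneg[OF F] set_poly_nonneg[OF link_subset_Pow[OF F]])
  have one_var: "(s - x i) * D \<le> m * (s ^ t - x i ^ t)" if "0 \<le> s" for s
  proof -
    have rest: "(\<Sum>v\<in>V - {i}. (x(i := s)) v ^ t) = (\<Sum>v\<in>V - {i}. x v ^ t)"
      by (rule sum.cong) auto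
    have "(\<Sum>v\<in>V. (x(i := s)) v ^ t) = 1 + (s ^ t - x i ^ t)"
      using x(2) unfolding sum.remove[OF V i] rest by simp
    moreover have "set_poly F (x(i := s)) \<le> m * (\<Sum>v\<in>V. (x(i := s)) v ^ t)"
      unfolding m_def using x(1) that by (intro max) simp
    ultimately have "set_poly F (x(i := s)) \<le> m * (1 + (s ^ t - x i ^ t))"
      by (simp only:)
    then show ?thesis
      using set_poly_update[OF V F, of x i s] by (simp add: m_def D_def algebra_simps)
  qed
  show ?thesis
  proof (cases "x i = 0")
    case True
    have "D \<le> 0"
    proof (rule ccontr)
      assume "\<not> D \<le> 0"
      then have "0 < D"
        by simp
      \<comment> \<open>A step so short that the gain s * D exceeds the loss, which is at most m * s ^ 2.\<close>
      define s where "s = min 1 (D / (m + 1))"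
      have s: "0 < s" "s \<le> 1" "s \<le> D / (m + 1)"
        using \<open>0 < D\<close> \<open>0 \<le> m\<close> by (auto simp: s_def)
      have "s * D \<le> m * s ^ t"
        using one_var[of s] s True t by (simp add: power_0_left)
      also have "s ^ t \<le> s ^ 2"
        using s t by (intro power_decreasing) auto
      then have "m * s ^ t \<le> s * (m * s)"
        using \<open>0 \<le> m\<close> mult_left_mono[of "s ^ t" "s ^ 2" m] by (simp add: power2_eq_square mult_ac)
      finally have "D \<le> m * s"
        using s by simp
      moreover have "(m + 1) * s \<le> D"
        using s(3) \<open>0 \<le> m\<close> by (simp add: field_simps)
      ultimately show False
        using s by (simp add: algebra_simps)
    qed
    then show ?thesis
      using \<open>0 \<le> D\<close> True t by (simp add: D_def)
  next
    case False
    then have "0 < x i"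
      using x(1)[of i] by simp
    define \<phi> where "\<phi> s = (s - x i) * D - m * (s ^ t - x i ^ t)" for s
    have "(\<phi> has_real_derivative D - m * (real t * x i ^ (t - 1))) (at (x i))"
      unfolding \<phi>_def by (auto intro!: derivative_eq_intros)
    moreover have "\<phi> s \<le> \<phi> (x i)" if "\<bar>x i - s\<bar> < x i" for s
      using one_var[of s] that by (simp add: \<phi>_def)
    ultimately have "D - m * (real t * x i ^ (t - 1)) = 0"
      using \<open>0 < x i\<close> by (intro DERIV_local_max) auto
    then show ?thesis
      by (simp add: D_def m_def)
  qed
qed

text \<open>A clique through \<open>i\<close> is met by the \<open>(t - 1)!\<close> orderings of its other vertices, which
  cancels the normalization of the tensor. So the eigenvalue equation says that the partial
  derivatives of the clique polynomial are \<open>l * x i ^ (t - 1)\<close>.\<close>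
lemma tensor_apply_clique_tensor:
  fixes x :: "'a \<Rightarrow> complex"
  assumes V: "finite V" and t: "1 \<le> t"
  shows "(\<Sum>js | set js \<subseteq> V \<and> length js = t - 1. clique_tensor V E t (i # js) * prod_list (map x js))
       = set_poly (link (cliques V E t) i) x"
proof -
  define F where "F = cliques V E t"
  define L where "L = {js. set js \<subseteq> V \<and> length js = t - 1}"
  have "finite L"
    unfolding L_def using V by (rule finite_lists_length_eq)
  have FV: "F \<subseteq> Pow V"
    by (auto simp: F_def cliques_def clique_def)
  have R: "R \<subseteq> V" "finite R" "card R = t - 1" if "R \<in> link F i" for R
  proof -
    show "R \<subseteq> V"
      using that link_subset_Pow[OF FV] by blast
    then show "finite R"
      using V finite_subset by blast
    then show "card R = t - 1"
      using that t by (auto simp: link_def F_def cliques_def)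
  qed
  have lists: "{js \<in> L. insert i (set js) \<in> F} = (\<Union>R\<in>link F i. permutations_of_set R)"
  proof (intro equalityI subsetI)
    fix js assume "js \<in> {js \<in> L. insert i (set js) \<in> F}"
    then have js: "set js \<subseteq> V" "length js = t - 1" "insert i (set js) \<in> F"
      by (auto simp: L_def)
    then have "card (set (i # js)) = length (i # js)"
      using t by (simp add: F_def cliques_def)
    then have "distinct (i # js)"
      by (rule card_distinct)
    then show "js \<in> (\<Union>R\<in>link F i. permutations_of_set R)"
      using js by (auto simp: link_def)
  next
    fix js assume "js \<in> (\<Union>R\<in>link F i. permutations_of_set R)"
    then obtain R' where R': "R' \<in> link F i" "js \<in> permutations_of_set R'"
      by auto
    then have "set js = R'" "distinct js"
      by (auto dest: permutations_of_setD)
    then show "js \<in> {js \<in> L. insert i (set js) \<in> F}"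
      using R[OF R'(1)] R'(1) distinct_card[of js] by (auto simp: L_def link_def)
  qed
  have "(\<Sum>js\<in>L. clique_tensor V E t (i # js) * prod_list (map x js))
      = (\<Sum>js | js \<in> L \<and> insert i (set js) \<in> F. prod_list (map x js) / fact (t - 1))"
    using \<open>finite L\<close> by (subst sum.inter_filter) (auto simp: clique_tensor_def F_def intro!: sum.cong)
  also have "\<dots> = (\<Sum>R\<in>link F i. \<Sum>js\<in>permutations_of_set R. prod_list (map x js) / fact (t - 1))"
    unfolding lists
  proof (rule sum.UNION_disjoint)
    show "finite (link F i)"
      using V link_subset_Pow[OF FV] by (meson finite_Pow_iff finite_subset)
    show "\<forall>R\<in>link F i. \<forall>R'\<in>link F i. R \<noteq> R' \<longrightarrow> permutations_of_set R \<inter> permutations_of_set R' = {}"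
      by (auto dest: permutations_of_setD)
  qed auto
  also have "\<dots> = (\<Sum>R\<in>link F i. \<Prod>v\<in>R. x v)"
  proof (rule sum.cong)
    fix R assume "R \<in> link F i"
    then have fin: "finite R" "card R = t - 1"
      using R by blast+
    have "(\<Sum>js\<in>permutations_of_set R. prod_list (map x js) / fact (t - 1))
        = (\<Sum>js\<in>permutations_of_set R. (\<Prod>v\<in>R. x v) / fact (t - 1))"
    proof (rule sum.cong)
      fix js assume "js \<in> permutations_of_set R"
      then have "set js = R" "distinct js"
        by (auto dest: permutations_of_setD)
      then show "prod_list (map x js) / fact (t - 1) = (\<Prod>v\<in>R. x v) / fact (t - 1)"
        using prod.distinct_set_conv_list[of js x] by simp
    qed simp
    then show "(\<Sum>js\<in>permutations_of_set R. prod_list (map x js) / fact (t - 1)) = (\<Prod>v\<in>R. x v)"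
      using fin by simp
  qed simp
  finally show ?thesis
    by (simp add: set_poly_def F_def L_def)
qed

text \<open>A maximizer of the clique polynomial is an eigenvector, by the Lagrange condition. No
  eigenvalue has a larger modulus: replace the coordinates of an eigenvector by their
  moduli, multiply each eigenvalue equation by its coordinate, and add them up with Euler's
  identity.\<close>
lemma clique_spectral_radius_eq_max:
  fixes V :: "'a set"
  assumes V: "finite V" "V \<noteq> {}" and t: "2 \<le> t"
  obtains x :: "'a \<Rightarrow> real" where "\<And>v. 0 \<le> x v" "(\<Sum>v\<in>V. x v ^ t) = 1"
    "clique_spectral_radius V E t = real t * set_poly (cliques V E t) x"
    "\<And>y. (\<And>v. v \<in> V \<Longrightarrow> 0 \<le> y v) \<Longrightarrow>
       set_poly (cliques V E t) y \<le> set_poly (cliques V E t) x * (\<Sum>v\<in>V. y v ^ t)"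
proof -
  define F where "F = cliques V E t"
  have F: "F \<subseteq> Pow V" and card: "\<And>K. K \<in> F \<Longrightarrow> card K = t"
    by (auto simp: F_def cliques_def clique_def)
  obtain x :: "'a \<Rightarrow> real" where x: "\<And>v. 0 \<le> x v" "(\<Sum>v\<in>V. x v ^ t) = 1"
    and max: "\<And>y. (\<And>v. v \<in> V \<Longrightarrow> 0 \<le> y v) \<Longrightarrow> set_poly F y \<le> set_poly F x * (\<Sum>v\<in>V. y v ^ t)"
    using set_poly_maximizer[OF V F card] t by auto
  define l where "l = real t * set_poly F x"
  have "0 \<le> l"
    unfolding l_def using set_poly_nonneg[OF F, of x] x(1) by simp
  have t1: "1 \<le> t"
    using t by simp
  have "tensor_spectral_radius V t (clique_tensor V E t) = cmod (complex_of_real l)"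
  proof (rule tensor_spectral_radius_eq_maximum)
    have "set_poly (link F i) (\<lambda>v. complex_of_real (x v)) = complex_of_real l * complex_of_real (x i) ^ (t - 1)"
      if "i \<in> V" for i
    proof -
      have "set_poly (link F i) (\<lambda>v. complex_of_real (x v)) = complex_of_real (set_poly (link F i) x)"
        by (simp add: set_poly_def)
      then show ?thesis
        using set_poly_maximizer_stationary[OF V(1) F t x max that] by (simp add: l_def)
    qed
    moreover have "\<exists>i\<in>V. complex_of_real (x i) \<noteq> 0"
    proof (rule ccontr)
      assume "\<not> ?thesis"
      then have "(\<Sum>v\<in>V. x v ^ t) = 0"
        using t by (intro sum.neutral) simp
      with x(2) show False
        by simp
    qed
    ultimately show "tensor_eigenvalue V t (clique_tensor V E t) (complex_of_real l)"
      unfolding tensor_eigenvalue_def tensor_apply_clique_tensor[OF V(1) t1] F_def[symmetric]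
      by (intro exI[of _ "\<lambda>v. complex_of_real (x v)"]) simp
  next
    fix k assume "tensor_eigenvalue V t (clique_tensor V E t) k"
    then obtain z i where z: "i \<in> V" "z i \<noteq> 0"
      and eig: "\<And>i. i \<in> V \<Longrightarrow> set_poly (link F i) z = k * z i ^ (t - 1)"
      unfolding tensor_eigenvalue_def tensor_apply_clique_tensor[OF V(1) t1] F_def[symmetric] by auto
    define y where "y v = cmod (z v)" for v
    have "cmod k * y v ^ t \<le> y v * set_poly (link F v) y" if "v \<in> V" for v
    proof -
      have "cmod k * y v ^ t = y v * cmod (k * z v ^ (t - 1))"
        using t power_eq_if[of "y v" t] by (simp add: y_def norm_mult norm_power)
      also have "cmod (k * z v ^ (t - 1)) = cmod (set_poly (link F v) z)"
        using eig[OF that] by simp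
      also have "\<dots> \<le> set_poly (link F v) y"
        unfolding set_poly_def y_def by (rule order_trans[OF norm_sum]) (simp add: prod_norm)
      finally show ?thesis
        by (simp add: y_def mult_left_mono)
    qed
    then have "(\<Sum>v\<in>V. cmod k * y v ^ t) \<le> (\<Sum>v\<in>V. y v * set_poly (link F v) y)"
      by (rule sum_mono)
    also have "\<dots> = real t * set_poly F y"
      by (rule sum_var_mult_set_poly_link[OF V(1) F card])
    also have "\<dots> \<le> real t * (set_poly F x * (\<Sum>v\<in>V. y v ^ t))"
      by (intro mult_left_mono max) (auto simp: y_def)
    finally have "cmod k * (\<Sum>v\<in>V. y v ^ t) \<le> l * (\<Sum>v\<in>V. y v ^ t)"
      by (simp add: sum_distrib_left l_def mult.assoc)
    moreover have "0 < (\<Sum>v\<in>V. y v ^ t)"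
      using V(1) z by (intro sum_pos2[of V i]) (auto simp: y_def)
    ultimately have "cmod k \<le> l"
      by simp
    then show "cmod k \<le> cmod (complex_of_real l)"
      using \<open>0 \<le> l\<close> by simp
  qed
  then have "clique_spectral_radius V E t = real t * set_poly F x"
    using \<open>0 \<le> l\<close> unfolding clique_spectral_radius_def l_def[symmetric] by simp
  with x max that show ?thesis
    unfolding F_def by blast
qed

section \<open>Cliques and clique densities\<close>

text \<open>The value of the elementary symmetric polynomial of degree \<open>t\<close> in \<open>a\<close> variables at the
  uniform probability vector.\<close>
definition clique_density :: "nat \<Rightarrow> nat \<Rightarrow> real" where
  "clique_density t a = real (a choose t) * real a powi (- int t)"

lemma clique_density_eq: "clique_density t a = real (a choose t) / real a ^ t"
  by (simp add: clique_density_def power_int_minus divide_inverse)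

lemma clique_density_nonneg: "0 \<le> clique_density t a"
  by (simp add: clique_density_eq)

lemma clique_density_pos: "1 \<le> t \<Longrightarrow> t \<le> a \<Longrightarrow> 0 < clique_density t a"
  by (simp add: clique_density_eq)

lemma clique_density_eq_0: "a < t \<Longrightarrow> clique_density t a = 0"
  by (simp add: clique_density_eq)

text \<open>For \<open>a \<ge> t\<close> the density is the product of the factors \<open>(1 - i / a) / (t - i)\<close> over
  \<open>i < t\<close>, each of which increases with \<open>a\<close>.\<close>
lemma clique_density_mono:
  assumes "1 \<le> t" "a \<le> b"
  shows "clique_density t a \<le> clique_density t b"
proof (cases "a < t")
  case True
  then show ?thesis
    using clique_density_nonneg by (simp add: clique_density_eq_0)
next
  case False
  have prod: "clique_density t c = (\<Prod>i<t. (1 - real i / real c) / real (t - i))" if "t \<le> c" for c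
  proof -
    have "real (c choose t) = (\<Prod>i<t. (real c - real i) / real (t - i))"
      by (simp add: binomial_gbinomial gbinomial_altdef_of_nat atLeast0LessThan)
    then have "clique_density t c = (\<Prod>i<t. (real c - real i) / real (t - i)) / (\<Prod>i<t. real c)"
      by (simp add: clique_density_eq)
    also have "\<dots> = (\<Prod>i<t. (real c - real i) / real (t - i) / real c)"
      by (rule prod_dividef[symmetric])
    also have "\<dots> = (\<Prod>i<t. (1 - real i / real c) / real (t - i))"
      using that assms(1) by (intro prod.cong) (auto simp: field_simps)
    finally show ?thesis .
  qed
  have "(\<Prod>i<t. (1 - real i / real a) / real (t - i)) \<le> (\<Prod>i<t. (1 - real i / real b) / real (t - i))"
  proof (intro prod_mono conjI divide_right_mono)
    fix i assume "i \<in> {..<t}"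
    then have "i < a" "0 < a"
      using False by auto
    then show "0 \<le> (1 - real i / real a) / real (t - i)"
      by (simp add: field_simps)
    show "1 - real i / real a \<le> 1 - real i / real b"
      using \<open>0 < a\<close> assms(2) by (simp add: frac_le)
  qed simp
  then show ?thesis
    using prod False assms(2) by simp
qed

lemma clique_subset: "clique V E K \<Longrightarrow> L \<subseteq> K \<Longrightarrow> clique V E L"
  by (auto simp: clique_def)

lemma finite_clique_sizes:
  assumes "finite V"
  shows "finite {card K |K. clique V E K \<and> Q K}"
proof (rule finite_subset)
  show "{card K |K. clique V E K \<and> Q K} \<subseteq> card ` Pow V"
    by (auto simp: clique_def)
  show "finite (card ` Pow V)"
    using assms by simp
qed

lemma card_le_vertex_clique_number:
  assumes "finite V" "clique V E K" "v \<in> K"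
  shows "card K \<le> vertex_clique_number V E v"
  unfolding vertex_clique_number_def
  by (rule Max_ge[OF finite_clique_sizes[OF assms(1)]]) (use assms in auto)

lemma vertex_clique_number_attained:
  assumes "finite V" "v \<in> V"
  obtains K where "clique V E K" "v \<in> K" "card K = vertex_clique_number V E v"
proof -
  have "clique V E {v}"
    using assms by (simp add: clique_def)
  then have "card {v} \<in> {card K |K. clique V E K \<and> v \<in> K}"
    by blast
  then have "vertex_clique_number V E v \<in> {card K |K. clique V E K \<and> v \<in> K}"
    unfolding vertex_clique_number_def
    by (intro Max_in[OF finite_clique_sizes[OF assms(1)]]) blast
  then show ?thesis
    using that by auto
qed

lemma card_le_clique_number:
  assumes "finite V" "clique V E K"
  shows "card K \<le> clique_number V E"
  unfolding clique_number_def
  using finite_clique_sizes[OF assms(1), of E "\<lambda>_. True"] assms by (intro Max_ge) auto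

lemma clique_number_attained:
  assumes "finite V"
  obtains K where "clique V E K" "card K = clique_number V E"
proof -
  have "clique V E {}"
    by (simp add: clique_def)
  then have "clique_number V E \<in> {card K |K. clique V E K}"
    unfolding clique_number_def
    using finite_clique_sizes[OF assms, of E "\<lambda>_. True"] by (intro Max_in) auto
  then show ?thesis
    using that by auto
qed

lemma vertex_clique_number_le:
  assumes "finite V" "v \<in> V"
  shows "vertex_clique_number V E v \<le> clique_number V E"
proof -
  obtain K where "clique V E K" "card K = vertex_clique_number V E v"
    using vertex_clique_number_attained[OF assms] .
  then show ?thesis
    using card_le_clique_number[OF assms(1), of E K] by simp
qed

lemma cliques_subset_Pow:
  assumes "finite V"
  shows "cliques V E t \<subseteq> Pow {v \<in> V. t \<le> vertex_clique_number V E v}"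
proof (intro subsetI PowI CollectI conjI)
  fix K v assume "K \<in> cliques V E t" "v \<in> K"
  then have K: "clique V E K" "card K = t"
    by (auto simp: cliques_def)
  then show "v \<in> V"
    using \<open>v \<in> K\<close> by (auto simp: clique_def)
  show "t \<le> vertex_clique_number V E v"
    using card_le_vertex_clique_number[OF assms K(1) \<open>v \<in> K\<close>] K(2) by simp
qed

text \<open>A set in which any two vertices lie in a common \<open>t\<close>-clique is itself a clique \<open>S\<close>, and on
  it the clique polynomial is an elementary symmetric polynomial. Maclaurin's inequality
  bounds it with the density of \<open>card S\<close>, which is at most the density at every vertex of
  \<open>S\<close>, since such a vertex lies in a clique of size \<open>card S\<close>.\<close>
lemma clique_motzkin_straus:
  fixes x :: "'a \<Rightarrow> real"
  assumes V: "finite V" and t: "2 \<le> t"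
    and W: "W = {v \<in> V. t \<le> vertex_clique_number V E v}"
    and x: "\<And>v. v \<in> W \<Longrightarrow> 0 \<le> x v"
  shows "set_poly (cliques V E t) x
       \<le> (\<Sum>v\<in>W. root t (clique_density t (vertex_clique_number V E v)) * x v) ^ t"
proof -
  define F where "F = cliques V E t"
  define g where "g v = root t (clique_density t (vertex_clique_number V E v))" for v
  have "finite W"
    using V W by simp
  have F: "F \<subseteq> Pow W"
    unfolding F_def W by (rule cliques_subset_Pow[OF V])
  have g: "0 < g v" if "v \<in> W" for v
    using that t by (simp add: g_def W clique_density_pos)
  have "set_poly F x \<le> (\<Sum>v\<in>W. g v * x v) ^ t"
  proof (rule weighted_motzkin_straus[OF \<open>finite W\<close> F g _ x])
    fix S and y :: "'a \<Rightarrow> real"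
    assume S: "S \<subseteq> W"
      and cov: "\<And>u v. u \<in> S \<Longrightarrow> v \<in> S \<Longrightarrow> u \<noteq> v \<Longrightarrow> \<exists>K\<in>F. u \<in> K \<and> v \<in> K"
      and y: "\<And>v. v \<in> W \<Longrightarrow> 0 \<le> y v" "\<And>v. v \<in> W - S \<Longrightarrow> y v = 0"
    have "finite S"
      using S \<open>finite W\<close> finite_subset by blast
    have "clique V E S"
      using S cov by (fastforce simp: clique_def W F_def cliques_def)
    have "finite F"
      using F \<open>finite W\<close> by (meson finite_Pow_iff finite_subset)
    \<comment> \<open>A monomial of a clique that leaves the support vanishes, and every t-subset of the
      support is a clique.\<close>
    have "set_poly F y = set_poly {K. K \<subseteq> S \<and> card K = t} y"
      unfolding set_poly_def
    proof (rule sum.mono_neutral_right[OF \<open>finite F\<close>])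
      show "{K. K \<subseteq> S \<and> card K = t} \<subseteq> F"
        using clique_subset[OF \<open>clique V E S\<close>] by (auto simp: F_def cliques_def)
      show "\<forall>K\<in>F - {K. K \<subseteq> S \<and> card K = t}. (\<Prod>v\<in>K. y v) = 0"
      proof
        fix K assume K: "K \<in> F - {K. K \<subseteq> S \<and> card K = t}"
        then have "\<not> K \<subseteq> S" "K \<subseteq> W"
          using F by (auto simp: F_def cliques_def)
        then obtain v where "v \<in> K" "v \<in> W - S"
          by blast
        moreover have "finite K"
          using \<open>K \<subseteq> W\<close> \<open>finite W\<close> finite_subset by blast
        ultimately show "(\<Prod>v\<in>K. y v) = 0"
          using y(2) by (intro prod_zero) auto
      qed
    qed
    also have "\<dots> \<le> real (card S choose t) * (sum y S / real (card S)) ^ t"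
    proof (rule maclaurin_inequality[OF \<open>finite S\<close> _ _ t])
      show "0 \<le> y i" if "i \<in> S" for i
        using that S y by auto
      show "sum y S = sum y S / real (card S) * real (card S)"
        using \<open>finite S\<close> by (cases "S = {}") auto
    qed
    also have "\<dots> = clique_density t (card S) * sum y S ^ t"
      by (simp add: clique_density_eq power_divide)
    also have "\<dots> = (\<Sum>v\<in>S. root t (clique_density t (card S)) * y v) ^ t"
      using t by (simp add: sum_distrib_left[symmetric] power_mult_distrib clique_density_nonneg)
    also have "\<dots> \<le> (\<Sum>v\<in>S. g v * y v) ^ t"
    proof (intro power_mono sum_mono mult_right_mono sum_nonneg)
      fix v assume "v \<in> S"
      then show "0 \<le> y v"
        using S y by auto
      then show "0 \<le> root t (clique_density t (card S)) * y v"
        using t by (simp add: clique_density_nonneg)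
      show "root t (clique_density t (card S)) \<le> g v"
        unfolding g_def using t card_le_vertex_clique_number[OF V \<open>clique V E S\<close> \<open>v \<in> S\<close>]
        by (intro real_root_le_mono clique_density_mono) auto
    qed
    also have "(\<Sum>v\<in>S. g v * y v) = (\<Sum>v\<in>W. g v * y v)"
      using \<open>finite W\<close> S y(2) by (intro sum.mono_neutral_left) auto
    finally show "set_poly F y \<le> (\<Sum>v\<in>W. g v * y v) ^ t" .
  qed
  then show ?thesis
    by (simp add: F_def g_def)
qed

section \<open>Transversals of partitions and multipartite clique edges\<close>

definition transversals :: "'a set set \<Rightarrow> nat \<Rightarrow> 'a set set" where
  "transversals P t = {K. K \<subseteq> \<Union>P \<and> card K = t \<and> (\<forall>C\<in>P. \<forall>u\<in>K \<inter> C. \<forall>v\<in>K \<inter> C. u = v)}"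

lemma finite_transversals:
  assumes "finite (\<Union>P)"
  shows "finite (transversals P t)"
  by (rule finite_subset[of _ "Pow (\<Union>P)"]) (use assms in \<open>auto simp: transversals_def\<close>)

text \<open>A transversal set either avoids the new class or contains exactly one of its elements.\<close>
lemma transversals_insert:
  assumes "finite C" "finite (\<Union>P)" "C \<inter> \<Union>P = {}"
  shows "card (transversals (insert C P) (Suc t))
       = card (transversals P (Suc t)) + card C * card (transversals P t)"
proof -
  let ?N = "(\<lambda>(c, K). insert c K) ` (C \<times> transversals P t)"
  have fin: "finite K" "C \<inter> K = {}" "K \<subseteq> \<Union>P" if "K \<in> transversals P k" for K k
    using that assms finite_subset[of K "\<Union>P"] by (auto simp: transversals_def)
  have "transversals (insert C P) (Suc t) = transversals P (Suc t) \<union> ?N"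
  proof (intro equalityI subsetI)
    fix K assume K: "K \<in> transversals (insert C P) (Suc t)"
    show "K \<in> transversals P (Suc t) \<union> ?N"
    proof (cases "K \<inter> C = {}")
      case True
      then have "K \<in> transversals P (Suc t)"
        using K by (auto simp: transversals_def)
      then show ?thesis ..
    next
      case False
      then obtain c where c: "c \<in> K" "c \<in> C"
        by auto
      have "K - {c} \<subseteq> \<Union>P"
        using K c by (auto simp: transversals_def)
      then have "K - {c} \<in> transversals P t"
        using K c by (auto simp: transversals_def)
      then have "(\<lambda>(c, K). insert c K) (c, K - {c}) \<in> ?N"
        using c by (intro imageI) simp
      then show ?thesis
        using c by (simp add: insert_absorb)
    qed
  next
    fix K assume "K \<in> transversals P (Suc t) \<union> ?N"
    then show "K \<in> transversals (insert C P) (Suc t)"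
    proof
      assume "K \<in> transversals P (Suc t)"
      then show ?thesis
        using assms(3) by (auto simp: transversals_def)
    next
      assume "K \<in> ?N"
      then obtain c L where L: "c \<in> C" "L \<in> transversals P t" "K = insert c L"
        by auto
      moreover have "c \<notin> L"
        using L fin(2)[OF L(2)] by blast
      then have "card K = Suc t"
        using L fin(1)[OF L(2)] by (simp add: transversals_def)
      ultimately show ?thesis
        using assms(3) fin(2)[OF L(2)] by (auto simp: transversals_def)
    qed
  qed
  moreover have "transversals P (Suc t) \<inter> ?N = {}"
    using fin(2)[of _ "Suc t"] by auto
  moreover have "inj_on (\<lambda>(c, K). insert c K) (C \<times> transversals P t)"
  proof (rule inj_onI, clarify)
    fix c K d L
    assume *: "c \<in> C" "d \<in> C" "K \<in> transversals P t" "L \<in> transversals P t" "insert c K = insert d L"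
    have "C \<inter> K = {}" "C \<inter> L = {}"
      using fin(2) *(3,4) by auto
    with *(1,2) have notin: "c \<notin> K" "c \<notin> L" "d \<notin> L"
      by auto
    have "c \<in> insert d L"
      using *(5) by auto
    with notin have "c = d"
      by simp
    with *(5) notin show "c = d \<and> K = L"
      by (simp add: insert_ident)
  qed
  then have "card ?N = card C * card (transversals P t)"
    by (simp add: card_image card_cartesian_product)
  ultimately show ?thesis
    using finite_transversals[OF assms(2)] assms(1) by (simp add: card_Un_disjoint)
qed

text \<open>The recursion for transversal sets is that of the elementary symmetric polynomials
  evaluated at the class sizes.\<close>
lemma card_transversals:
  assumes "finite P" "\<And>C. C \<in> P \<Longrightarrow> finite C" "disjoint P"
  shows "real (card (transversals P t)) = esym t P (\<lambda>C. real (card C))"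
  using assms
proof (induction P arbitrary: t rule: finite_induct)
  case empty
  have "transversals {} k = (if k = 0 then {{} :: 'a set} else {})" for k
    by (auto simp: transversals_def)
  moreover have "{K. K \<subseteq> {} \<and> card K = k} = (if k = 0 then {{} :: 'a set set} else {})" for k
    by auto
  ultimately show ?case
    by (simp add: set_poly_def)
next
  case (insert C P)
  have fin: "finite C" "finite (\<Union>P)" "disjoint P"
    using insert by (auto simp: pairwise_insert)
  have "C \<inter> \<Union>P = {}"
    using insert.prems(2) insert.hyps(2) by (fastforce simp: pairwise_def disjnt_def)
  show ?case
  proof (cases t)
    case 0
    have "finite (\<Union>(insert C P))"
      using fin by simp
    then have "transversals (insert C P) 0 = {{}}"
      by (auto simp: transversals_def dest: finite_subset)
    then show ?thesis
      using insert.hyps by (simp add: 0 esym_0)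
  next
    case (Suc k)
    then show ?thesis
      using transversals_insert[OF fin(1,2) \<open>C \<inter> \<Union>P = {}\<close>, of k] insert fin
      by (simp add: esym_insert)
  qed
qed

lemma transversals_full:
  assumes "finite P" "partition_on W P" "v \<in> W"
  obtains T where "T \<in> transversals P (card P)" "v \<in> T"
proof -
  define f where "f C = (if v \<in> C then v else SOME w. w \<in> C)" for C
  have f: "f C \<in> C" if "C \<in> P" for C
    using that partition_onD3[OF assms(2)] some_in_eq[of C] by (auto simp: f_def)
  have same: "C = D" if "C \<in> P" "D \<in> P" "u \<in> C" "u \<in> D" for C D u
    using partition_onD2[OF assms(2)] that by (auto simp: pairwise_def disjnt_def)
  have "inj_on f P"
    using f same by (metis inj_onI)
  then have "f ` P \<in> transversals P (card P)"
    using f same by (auto simp: transversals_def card_image) metis+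
  moreover obtain C where "C \<in> P" "v \<in> C"
    using assms(2,3) by (auto simp: partition_on_def)
  then have "v \<in> f ` P"
    by (force simp: f_def)
  ultimately show ?thesis
    using that by blast
qed

lemma transversals_card_le:
  assumes "finite P" "K \<in> transversals P k"
  shows "k \<le> card P"
proof -
  define f where "f v = (SOME C. C \<in> P \<and> v \<in> C)" for v
  have f: "f v \<in> P \<and> v \<in> f v" if "v \<in> K" for v
  proof -
    have "\<exists>C. C \<in> P \<and> v \<in> C"
      using that assms(2) by (auto simp: transversals_def)
    then show ?thesis
      unfolding f_def by (rule someI_ex)
  qed
  have "inj_on f K"
  proof (rule inj_onI)
    fix u v assume "u \<in> K" "v \<in> K" "f u = f v"
    then show "u = v"
      using f[of u] f[of v] assms(2) by (auto simp: transversals_def)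
  qed
  then have "card K \<le> card P"
    using f assms(1) by (intro card_inj_on_le) auto
  then show ?thesis
    using assms(2) by (simp add: transversals_def)
qed

definition multipartite_edges :: "'a set set \<Rightarrow> 'a set set" where
  "multipartite_edges P = {{u, v} |u v. u \<in> \<Union>P \<and> v \<in> \<Union>P \<and> \<not> (\<exists>C\<in>P. u \<in> C \<and> v \<in> C)}"

lemma pair_in_multipartite_edges_iff:
  "{u, v} \<in> multipartite_edges P \<longleftrightarrow> u \<in> \<Union>P \<and> v \<in> \<Union>P \<and> \<not> (\<exists>C\<in>P. u \<in> C \<and> v \<in> C)"
  unfolding multipartite_edges_def by (auto simp: doubleton_eq_iff)

lemma transversal_is_clique:
  assumes "\<Union>P \<subseteq> V" "multipartite_edges P \<subseteq> E" "K \<in> transversals P k"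
  shows "clique V E K"
  unfolding clique_def
proof (intro conjI ballI impI)
  show "K \<subseteq> V"
    using assms by (auto simp: transversals_def)
  fix u v assume "u \<in> K" "v \<in> K" "u \<noteq> v"
  then have "{u, v} \<in> multipartite_edges P"
    unfolding pair_in_multipartite_edges_iff using assms(3) by (auto simp: transversals_def)
  then show "{u, v} \<in> E"
    using assms(2) by blast
qed

text \<open>Any two vertices of a clique with at least \<open>t\<close> vertices lie in a \<open>t\<close>-clique inside it, so
  all edges of such a clique are kept in the graph of clique edges.\<close>
lemma clique_is_transversal:
  assumes "clique_edges V E t = multipartite_edges P" "2 \<le> t" and K: "clique V E K" "t \<le> card K"
  shows "K \<in> transversals P (card K)"
proof -
  have edge: "{u, v} \<in> multipartite_edges P" if uv: "u \<in> K" "v \<in> K" "u \<noteq> v" for u v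
  proof -
    obtain L where L: "{u, v} \<subseteq> L" "L \<subseteq> K" "card L = t"
      using exists_subset_between[of "{u, v}" t K] uv K assms(2) card_ge_0_finite[of K] by auto
    then have "L \<in> cliques V E t"
      using clique_subset[OF K(1)] by (simp add: cliques_def)
    moreover have "{u, v} \<in> E"
      using K(1) uv by (simp add: clique_def)
    ultimately show ?thesis
      using L(1) assms(1) by (auto simp: clique_edges_def)
  qed
  have "u \<in> \<Union>P" if "u \<in> K" for u
  proof -
    have "\<not> K \<subseteq> {u}"
      using K(2) assms(2) card_mono[of "{u}" K] by auto
    then obtain v where "v \<in> K" "u \<noteq> v"
      by auto
    then show ?thesis
      using edge[OF that] pair_in_multipartite_edges_iff by metis
  qed
  moreover have "u = v" if "C \<in> P" "u \<in> K \<inter> C" "v \<in> K \<inter> C" for C u v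
    using edge[of u v] that unfolding pair_in_multipartite_edges_iff by blast
  ultimately show ?thesis
    unfolding transversals_def by blast
qed

lemma cliques_eq_transversals:
  assumes "\<Union>P \<subseteq> V" "clique_edges V E t = multipartite_edges P" "2 \<le> t"
  shows "cliques V E t = transversals P t"
proof (intro equalityI subsetI)
  fix K assume "K \<in> cliques V E t"
  then have "clique V E K" "card K = t"
    by (auto simp: cliques_def)
  then show "K \<in> transversals P t"
    using clique_is_transversal[OF assms(2,3), of K] by simp
next
  fix K assume "K \<in> transversals P t"
  moreover have "multipartite_edges P \<subseteq> E"
    using assms(2) by (auto simp: clique_edges_def)
  ultimately show "K \<in> cliques V E t"
    using transversal_is_clique[OF assms(1)] by (auto simp: cliques_def transversals_def)
qed

text \<open>A maximum clique of the graph meets each class at most once, so there are at least as many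
  classes as its size. In turn every vertex of \<open>W\<close> lies in a transversal of all classes,
  which is a clique of the graph. A vertex outside \<open>W\<close> in a clique of size at least \<open>t\<close>
  would be an endpoint of a clique edge.\<close>
lemma multipartite_clique_numbers:
  assumes V: "finite V" and t: "2 \<le> t" "t \<le> clique_number V E"
    and P: "partition_on W P" "W \<subseteq> V" and edges: "clique_edges V E t = multipartite_edges P"
  shows "card P = clique_number V E"
    and "v \<in> W \<Longrightarrow> vertex_clique_number V E v = clique_number V E"
    and "v \<in> V - W \<Longrightarrow> vertex_clique_number V E v < t"
proof -
  have "finite P"
    using P V finite_elements finite_subset by metis
  have UP: "\<Union>P = W"
    using P(1) by (simp add: partition_on_def)
  have "multipartite_edges P \<subseteq> E"
    using edges by (auto simp: clique_edges_def)
  then have T: "clique V E K" if "K \<in> transversals P k" for K k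
    using transversal_is_clique[of P V E K k] UP P(2) that by auto
  obtain K where K: "clique V E K" "card K = clique_number V E"
    using clique_number_attained[OF V] .
  then have KT: "K \<in> transversals P (clique_number V E)"
    using clique_is_transversal[OF edges t(1) K(1)] t by simp
  have le: "card P \<le> vertex_clique_number V E w" if w: "w \<in> W" for w
  proof -
    obtain L where L: "L \<in> transversals P (card P)" "w \<in> L"
      using transversals_full[OF \<open>finite P\<close> P(1) w] .
    have "card L \<le> vertex_clique_number V E w"
      by (rule card_le_vertex_clique_number[OF V T[OF L(1)] L(2)])
    then show ?thesis
      using L(1) by (simp add: transversals_def)
  qed
  have "K \<noteq> {}"
    using K t by auto
  then obtain w where "w \<in> K"
    by blast
  then have "w \<in> W"
    using KT UP by (auto simp: transversals_def)
  have ge: "clique_number V E \<le> card P"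
    by (rule transversals_card_le[OF \<open>finite P\<close> KT])
  show "card P = clique_number V E"
    using ge le[OF \<open>w \<in> W\<close>] vertex_clique_number_le[OF V, of w E] \<open>w \<in> W\<close> P(2) by force
  show "vertex_clique_number V E v = clique_number V E" if "v \<in> W"
    using ge le[OF that] vertex_clique_number_le[OF V, of v E] that P(2) by force
  show "vertex_clique_number V E v < t" if "v \<in> V - W"
  proof (rule ccontr)
    assume "\<not> ?thesis"
    moreover obtain L where L: "clique V E L" "v \<in> L" "card L = vertex_clique_number V E v"
      using vertex_clique_number_attained[OF V, of v] \<open>v \<in> V - W\<close> by blast
    ultimately have "L \<in> transversals P (card L)"
      by (intro clique_is_transversal[OF edges t(1)]) simp_all
    then show False
      using L(2) UP that by (auto simp: transversals_def)
  qed
qed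

lemma complete_regular_partite_iff:
  "complete_regular_partite k W E \<longleftrightarrow>
     (\<exists>P. partition_on W P \<and> finite P \<and> card P = k \<and> (\<exists>s. \<forall>C\<in>P. card C = s)
        \<and> E = multipartite_edges P)"
  unfolding complete_regular_partite_def multipartite_edges_def
  by (intro iff_exI conj_cong refl) (simp add: partition_on_def)

section \<open>The bound and its equality case\<close>

definition vertex_density :: "'a set \<Rightarrow> 'a set set \<Rightarrow> nat \<Rightarrow> 'a \<Rightarrow> real" where
  "vertex_density V E t v = clique_density t (vertex_clique_number V E v)"

text \<open>The root of order \<open>t * (t - 1)\<close> supplies the vector \<open>h\<close> for Hoelder's inequality: its
  powers are the terms of the sum in the bound and the weights of the Motzkin-Straus
  inequality.\<close>
lemma root_powers:
  assumes "2 \<le> t" "0 \<le> c"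
  shows "root (t * (t - 1)) c ^ t = root (t - 1) c"
    and "root (t * (t - 1)) c ^ (t - 1) = root t c"
proof -
  have "root (t * (t - 1)) c = root t (root (t - 1) c)"
    by (rule real_root_mult_exp)
  then show "root (t * (t - 1)) c ^ t = root (t - 1) c"
    using assms by simp
  have "root (t * (t - 1)) c = root (t - 1) (root t c)"
    using real_root_mult_exp[of "t - 1" t c] by (simp add: mult.commute)
  then show "root (t * (t - 1)) c ^ (t - 1) = root t c"
    using assms by simp
qed

text \<open>The Motzkin-Straus inequality for the clique polynomial followed by Hoelder's inequality.
  When the outer terms agree, both inequalities are equalities. The factor \<open>m\<close> is nonzero
  because the bound \<open>H\<close> is positive, as a maximum clique contains a vertex of positive
  density.\<close>
lemma clique_poly_bound:
  fixes V :: "'a set" and E :: "'a set set" and t :: nat and x :: "'a \<Rightarrow> real"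
  defines "H \<equiv> (\<Sum>v\<in>V. root (t - 1) (vertex_density V E t v))"
  assumes V: "finite V" and t: "2 \<le> t" "t \<le> clique_number V E"
    and W: "W = {v \<in> V. t \<le> vertex_clique_number V E v}"
    and x: "\<And>v. v \<in> V \<Longrightarrow> 0 \<le> x v"
  shows "0 < H"
    and "set_poly (cliques V E t) x \<le> H ^ (t - 1) * (\<Sum>v\<in>V. x v ^ t)"
    and "set_poly (cliques V E t) x = H ^ (t - 1) * (\<Sum>v\<in>V. x v ^ t) \<Longrightarrow> (\<Sum>v\<in>V. x v ^ t) = 1 \<Longrightarrow>
      set_poly (cliques V E t) x = (\<Sum>v\<in>W. root t (vertex_density V E t v) * x v) ^ t \<and>
      (\<exists>m>0. \<forall>v\<in>V. x v = m * root (t * (t - 1)) (vertex_density V E t v))"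
proof -
  define F where "F = cliques V E t"
  define h where "h v = root (t * (t - 1)) (vertex_density V E t v)" for v
  have dens: "0 \<le> vertex_density V E t v" for v
    by (simp add: vertex_density_def clique_density_nonneg)
  have h: "h v ^ t = root (t - 1) (vertex_density V E t v)"
    "h v ^ (t - 1) = root t (vertex_density V E t v)" "0 \<le> h v" for v
    unfolding h_def using root_powers[OF t(1) dens] t dens by auto
  have H: "H = (\<Sum>v\<in>V. h v ^ t)"
    by (simp add: H_def h(1))
  have dens0: "vertex_density V E t v = 0" if "v \<in> V - W" for v
    using that W by (auto simp: vertex_density_def intro: clique_density_eq_0)
  show "0 < H"
  proof -
    obtain K where K: "clique V E K" "card K = clique_number V E"
      using clique_number_attained[OF V] .
    then have "K \<noteq> {}"
      using t by auto
    then obtain w where "w \<in> K"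
      by blast
    have "t \<le> vertex_clique_number V E w"
      using card_le_vertex_clique_number[OF V K(1) \<open>w \<in> K\<close>] K(2) t by simp
    then have "0 < vertex_density V E t w"
      unfolding vertex_density_def using t by (intro clique_density_pos) auto
    moreover have "w \<in> V"
      using K(1) \<open>w \<in> K\<close> by (auto simp: clique_def)
    ultimately show ?thesis
      unfolding H_def using V t dens by (intro sum_pos2[of V w]) auto
  qed
  define L where "L = (\<Sum>v\<in>V. h v ^ (t - 1) * x v)"
  have LW: "L = (\<Sum>v\<in>W. root t (vertex_density V E t v) * x v)"
    unfolding L_def h(2) using V W dens0 by (intro sum.mono_neutral_right) auto
  have ms: "set_poly F x \<le> L ^ t"
    unfolding LW F_def vertex_density_def
    by (rule clique_motzkin_straus[OF V t(1) W]) (use x W in auto)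
  have holder: "L ^ t \<le> H ^ (t - 1) * (\<Sum>v\<in>V. x v ^ t)"
    unfolding L_def H by (rule holder_power(1)[OF V]) (use h x t \<open>0 < H\<close> H in auto)
  show "set_poly (cliques V E t) x \<le> H ^ (t - 1) * (\<Sum>v\<in>V. x v ^ t)"
    using ms holder by (simp add: F_def)
  assume "set_poly (cliques V E t) x = H ^ (t - 1) * (\<Sum>v\<in>V. x v ^ t)"
    and norm: "(\<Sum>v\<in>V. x v ^ t) = 1"
  then have eq: "set_poly F x = L ^ t" "L ^ t = H ^ (t - 1) * (\<Sum>v\<in>V. x v ^ t)"
    using ms holder by (auto simp: F_def)
  have "x v = L / H * h v" if "v \<in> V" for v
    unfolding L_def H
    by (rule holder_power(2)[OF V]) (use h x t \<open>0 < H\<close> H eq(2) that L_def in auto)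
  moreover have "0 < L / H"
  proof -
    have "0 \<le> L"
      unfolding L_def using h(3) x by (intro sum_nonneg mult_nonneg_nonneg zero_le_power)
    moreover have "0 < L ^ t"
      using eq(2) norm \<open>0 < H\<close> by simp
    ultimately have "0 < L"
      using t by (cases "L = 0") (auto simp: power_0_left)
    then show ?thesis
      using \<open>0 < H\<close> by simp
  qed
  ultimately show "set_poly (cliques V E t) x = (\<Sum>v\<in>W. root t (vertex_density V E t v) * x v) ^ t \<and>
      (\<exists>m>0. \<forall>v\<in>V. x v = m * root (t * (t - 1)) (vertex_density V E t v))"
    using eq(1) LW unfolding F_def h_def by blast
qed

text \<open>By the form of \<open>x\<close>, its support is the set \<open>W\<close> of vertices that lie in a \<open>t\<close>-clique. On
  \<open>W\<close>, lying in no common \<open>t\<close>-clique is a transitive relation, hence an equivalence, and its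
  classes make the graph of clique edges complete multipartite. Then all vertices of \<open>W\<close>
  have the same clique number, so that \<open>x\<close> is constant on \<open>W\<close>, and the equality becomes a
  formula for the number of \<open>t\<close>-cliques, that is, of transversal \<open>t\<close>-sets. It is the
  equality case of Maclaurin's inequality for the class sizes.\<close>
lemma equality_imp_multipartite:
  fixes V :: "'a set" and x :: "'a \<Rightarrow> real"
  assumes graph: "simple_graph V E" and t: "2 \<le> t" "t \<le> clique_number V E"
    and W: "W = {v \<in> V. t \<le> vertex_clique_number V E v}"
    and eq: "set_poly (cliques V E t) x = (\<Sum>v\<in>W. root t (vertex_density V E t v) * x v) ^ t"
    and m: "0 < m" "\<And>v. v \<in> V \<Longrightarrow> x v = m * root (t * (t - 1)) (vertex_density V E t v)"
  shows "complete_regular_partite (clique_number V E) W (clique_edges V E t)"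
proof -
  define F where "F = cliques V E t"
  define k where "k = clique_number V E"
  define g where "g v = root t (vertex_density V E t v)" for v
  have V: "finite V"
    using graph by (simp add: simple_graph_def)
  have "finite W" "W \<subseteq> V"
    using V W by auto
  have F: "F \<subseteq> Pow W"
    unfolding F_def W by (rule cliques_subset_Pow[OF V])
  have dens: "0 < vertex_density V E t v" if "v \<in> W" for v
    using that t by (simp add: W vertex_density_def clique_density_pos)
  have g: "0 < g v" and x: "0 < x v" if "v \<in> W" for v
    using dens[OF that] m that t \<open>W \<subseteq> V\<close> by (auto simp: g_def)
  define r where "r = {(u, v). u \<in> W \<and> v \<in> W \<and> (u = v \<or> (\<forall>K\<in>F. u \<in> K \<longrightarrow> v \<notin> K))}"
  have r: "(u, w) \<in> r" if "(u, v) \<in> r" "(v, w) \<in> r" for u v w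
  proof (cases "u = v \<or> v = w \<or> u = w")
    case True
    then show ?thesis
      using that by (auto simp: r_def)
  next
    case False
    have "w \<notin> K" if K: "K \<in> F" "u \<in> K" for K
    proof (rule motzkin_straus_equality_nonadjacent_trans[OF \<open>finite W\<close> F g _ x, where u=u and v=v and w=w and t=t])
      show "set_poly F y \<le> (\<Sum>v\<in>W. g v * y v) ^ t" if "\<And>v. v \<in> W \<Longrightarrow> 0 \<le> y v" for y
        unfolding F_def g_def vertex_density_def by (rule clique_motzkin_straus[OF V t(1) W that])
      show "set_poly F x = (\<Sum>v\<in>W. g v * x v) ^ t"
        using eq by (simp add: F_def g_def)
    qed (use False K \<open>(u, v) \<in> r\<close> \<open>(v, w) \<in> r\<close> in \<open>auto simp: r_def\<close>)
    then show ?thesis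
      using that by (auto simp: r_def)
  qed
  have "equiv W r"
  proof (rule equivI)
    show "r \<subseteq> W \<times> W" "refl_on W r"
      by (auto simp: r_def refl_on_def)
    show "sym r"
      by (auto simp: r_def sym_def)
    show "trans r"
      using r by (auto simp: trans_def)
  qed
  define P where "P = W // r"
  have P: "partition_on W P"
    unfolding P_def by (rule partition_on_quotient[OF \<open>equiv W r\<close>])
  have UP: "\<Union>P = W"
    using P by (simp add: partition_on_def)
  have "finite P"
    using finite_elements[OF \<open>finite W\<close> P] .
  have same: "(\<exists>C\<in>P. u \<in> C \<and> v \<in> C) \<longleftrightarrow> (u, v) \<in> r" for u v
  proof
    assume "\<exists>C\<in>P. u \<in> C \<and> v \<in> C"
    then show "(u, v) \<in> r"
      using quotient_eq_iff[OF \<open>equiv W r\<close>] unfolding P_def by blast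
  next
    assume "(u, v) \<in> r"
    then have "u \<in> W" "v \<in> r `` {u}" "u \<in> r `` {u}"
      by (auto simp: r_def)
    then show "\<exists>C\<in>P. u \<in> C \<and> v \<in> C"
      unfolding P_def by (intro bexI[of _ "r `` {u}"]) (auto simp: quotientI)
  qed
  have edges: "clique_edges V E t = multipartite_edges P"
  proof (intro equalityI subsetI)
    fix e assume "e \<in> clique_edges V E t"
    then obtain K where K: "e \<in> E" "K \<in> F" "e \<subseteq> K"
      by (auto simp: clique_edges_def F_def)
    then obtain u v where e: "e = {u, v}" "u \<noteq> v"
      using graph by (auto simp: simple_graph_def card_2_iff)
    then have "u \<in> W" "v \<in> W" "(u, v) \<notin> r"
      using K F by (auto simp: r_def)
    then show "e \<in> multipartite_edges P"
      unfolding e(1) pair_in_multipartite_edges_iff UP same by blast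
  next
    fix e assume "e \<in> multipartite_edges P"
    then obtain u v where e: "e = {u, v}" "u \<in> W" "v \<in> W" "(u, v) \<notin> r"
      unfolding multipartite_edges_def UP same by blast
    then obtain K where K: "K \<in> F" "u \<in> K" "v \<in> K" "u \<noteq> v"
      by (auto simp: r_def)
    then show "e \<in> clique_edges V E t"
      using e(1) by (auto simp: clique_edges_def F_def cliques_def clique_def)
  qed
  note nums = multipartite_clique_numbers[OF V t P \<open>W \<subseteq> V\<close> edges]
  have "card P = k"
    using nums(1) by (simp add: k_def)
  have "0 < k"
    using t by (simp add: k_def)
  define c where "c = clique_density t k"
  define \<xi> where "\<xi> = m * root (t * (t - 1)) c"
  have const: "vertex_density V E t v = c" "x v = \<xi>" if "v \<in> W" for v
    using m(2)[of v] that nums(2)[OF that] \<open>W \<subseteq> V\<close>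
    by (auto simp: vertex_density_def c_def k_def \<xi>_def)
  have "0 < c"
    unfolding c_def k_def using t by (intro clique_density_pos) auto
  then have "0 < \<xi>"
    using m(1) t by (simp add: \<xi>_def)
  have "set_poly F x = set_poly F (\<lambda>_. \<xi>)"
    by (rule set_poly_cong[OF F]) (simp add: const)
  also have "\<dots> = real (card F) * \<xi> ^ t"
    by (simp add: set_poly_def F_def cliques_def)
  finally have "real (card F) * \<xi> ^ t = (\<Sum>v\<in>W. root t c * \<xi>) ^ t"
    using eq const by (simp add: F_def)
  also have "\<dots> = c * real (card W) ^ t * \<xi> ^ t"
    using \<open>0 < c\<close> t by (simp add: power_mult_distrib)
  finally have "real (card F) = c * real (card W) ^ t"
    using \<open>0 < \<xi>\<close> by simp
  then have cardF: "real (card F) = real (card P choose t) * (real (card W) / real (card P)) ^ t"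
    by (simp add: c_def clique_density_eq power_divide \<open>card P = k\<close>)
  have finC: "finite C" "C \<noteq> {}" if "C \<in> P" for C
    using that UP \<open>finite W\<close> partition_onD3[OF P] by (auto intro: finite_subset)
  have "esym t P (\<lambda>C. real (card C)) = real (card F)"
    using card_transversals[OF \<open>finite P\<close> finC(1) partition_onD2[OF P], of t]
      cliques_eq_transversals[of P V E t] UP \<open>W \<subseteq> V\<close> edges t(1) by (simp add: F_def)
  note esym_eq = this[unfolded cardF]
  have sizes: "real (card C) = real (card D)" if "C \<in> P" "D \<in> P" for C D
  proof (rule maclaurin_equality[OF \<open>finite P\<close> _ _ t(1) _ esym_eq that])
    show "0 < real (card C)" if "C \<in> P" for C
      using finC[OF that] by (simp add: card_gt_0_iff)
    show "(\<Sum>C\<in>P. real (card C)) = real (card W) / real (card P) * real (card P)"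
      using product_partition[OF P finC(1)] \<open>0 < k\<close> \<open>card P = k\<close> by simp
    show "t \<le> card P"
      using t \<open>card P = k\<close> by (simp add: k_def)
  qed
  obtain D where "D \<in> P"
    using \<open>0 < k\<close> \<open>card P = k\<close> by fastforce
  have "card C = card D" if "C \<in> P" for C
    using sizes[OF that \<open>D \<in> P\<close>] by simp
  then show ?thesis
    unfolding complete_regular_partite_iff
    using P \<open>finite P\<close> nums(1) edges by blast
qed

text \<open>The indicator vector of the nonisolated vertices attains the bound: with \<open>k\<close> classes of
  size \<open>s\<close> both sides are equal to \<open>(k choose t) * s ^ t\<close>.\<close>
lemma multipartite_imp_equality:
  fixes V :: "'a set"
  assumes V: "finite V" and t: "2 \<le> t" "t \<le> clique_number V E" and "W \<subseteq> V"
    and turan: "complete_regular_partite (clique_number V E) W (clique_edges V E t)"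
  shows "set_poly (cliques V E t) (\<lambda>v. if v \<in> W then 1 else 0)
       = (\<Sum>v\<in>V. root (t - 1) (vertex_density V E t v)) ^ (t - 1) * real (card W)"
proof -
  define F where "F = cliques V E t"
  define k where "k = clique_number V E"
  obtain P s where P: "partition_on W P" "finite P" "card P = k" and s: "\<And>C. C \<in> P \<Longrightarrow> card C = s"
    and edges: "clique_edges V E t = multipartite_edges P"
    using turan unfolding complete_regular_partite_iff k_def by blast
  have UP: "\<Union>P = W"
    using P(1) by (simp add: partition_on_def)
  have "finite W" "0 < k"
    using V \<open>W \<subseteq> V\<close> finite_subset t by (auto simp: k_def)
  have finC: "finite C" "C \<noteq> {}" if "C \<in> P" for C
    using that UP \<open>finite W\<close> partition_onD3[OF P(1)] by (auto intro: finite_subset)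
  have "0 < s"
  proof -
    obtain C where "C \<in> P"
      using \<open>0 < k\<close> P(3) by fastforce
    then show ?thesis
      using finC[of C] s[of C] by (auto simp: card_gt_0_iff)
  qed
  have cardW: "card W = k * s"
    using product_partition[OF P(1) finC(1)] s P(3) by simp
  have F: "F = transversals P t"
    unfolding F_def by (rule cliques_eq_transversals) (use UP \<open>W \<subseteq> V\<close> edges t in auto)
  have "set_poly F (\<lambda>v. if v \<in> W then 1 else 0 :: real) = set_poly F (\<lambda>_. 1)"
    by (rule set_poly_cong[of _ W]) (auto simp: F transversals_def UP)
  also have "\<dots> = real (card F)"
    by (simp add: set_poly_def)
  also have "\<dots> = esym t P (\<lambda>C. real (card C))"
    unfolding F by (rule card_transversals[OF P(2) finC(1) partition_onD2[OF P(1)]])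
  also have "\<dots> = esym t P (\<lambda>_. real s)"
    by (rule set_poly_cong[of _ P]) (auto simp: s)
  also have "\<dots> = real (k choose t) * real s ^ t"
    using esym_const[OF P(2)] P(3) by simp
  finally have poly: "set_poly F (\<lambda>v. if v \<in> W then 1 else 0 :: real) = real (k choose t) * real s ^ t" .
  note nums = multipartite_clique_numbers[OF V t P(1) \<open>W \<subseteq> V\<close> edges]
  have "(\<Sum>v\<in>V. root (t - 1) (vertex_density V E t v)) = (\<Sum>v\<in>W. root (t - 1) (clique_density t k))"
  proof (rule sum.mono_neutral_cong_right[OF V \<open>W \<subseteq> V\<close>])
    show "\<forall>v\<in>V - W. root (t - 1) (vertex_density V E t v) = 0"
      using nums(3) by (simp add: vertex_density_def clique_density_eq_0)
    show "root (t - 1) (vertex_density V E t v) = root (t - 1) (clique_density t k)" if "v \<in> W" for v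
      using nums(2)[OF that] by (simp add: vertex_density_def k_def)
  qed
  also have "\<dots> = real (card W) * root (t - 1) (clique_density t k)"
    by simp
  finally have "(\<Sum>v\<in>V. root (t - 1) (vertex_density V E t v)) ^ (t - 1) * real (card W)
      = real (card W) ^ (t - 1) * real (card W) * clique_density t k"
    using t by (simp add: power_mult_distrib clique_density_nonneg)
  also have "real (card W) ^ (t - 1) * real (card W) = real (card W) ^ t"
    using t by (intro power_minus_mult) simp
  also have "real (card W) ^ t * clique_density t k = real (k choose t) * real s ^ t"
    using \<open>0 < k\<close> by (simp add: cardW clique_density_eq power_mult_distrib)
  finally show ?thesis
    using poly by (simp add: F_def)
qed

theorem corollary3p5:
  fixes V :: "'a set" and E :: "'a set set" and t :: nat
  assumes "simple_graph V E"
    and "2 \<le> t" and "t \<le> clique_number V E"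
  shows "clique_spectral_radius V E t
           \<le> real t * (\<Sum>v\<in>V. root (t - 1)
               (real (vertex_clique_number V E v choose t)
                  * real (vertex_clique_number V E v) powi (- int t))) ^ (t - 1)
       \<and> (clique_spectral_radius V E t
           = real t * (\<Sum>v\<in>V. root (t - 1)
               (real (vertex_clique_number V E v choose t)
                  * real (vertex_clique_number V E v) powi (- int t))) ^ (t - 1)
          \<longleftrightarrow> complete_regular_partite_isolated (clique_number V E) V (clique_edges V E t))"
  unfolding clique_density_def[symmetric] vertex_density_def[symmetric]
proof -
  note t = assms(2,3)
  have V: "finite V"
    using assms(1) by (simp add: simple_graph_def)
  define F where "F = cliques V E t"
  define W where "W = {v \<in> V. t \<le> vertex_clique_number V E v}"
  define H where "H = (\<Sum>v\<in>V. root (t - 1) (vertex_density V E t v))"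
  define \<rho> where "\<rho> = clique_spectral_radius V E t"
  note bound = clique_poly_bound[OF V t W_def, folded F_def H_def]
  have "0 < H"
    by (rule bound(1)[of "\<lambda>_. 0"]) simp
  then have "V \<noteq> {}"
    by (auto simp: H_def)
  then obtain x where x: "\<And>v. 0 \<le> x v" "(\<Sum>v\<in>V. x v ^ t) = 1"
    and \<rho>: "\<rho> = real t * set_poly F x"
    and max: "\<And>y. (\<And>v. v \<in> V \<Longrightarrow> 0 \<le> y v) \<Longrightarrow> set_poly F y \<le> set_poly F x * (\<Sum>v\<in>V. y v ^ t)"
    using clique_spectral_radius_eq_max[OF V _ t(1), of E] unfolding F_def \<rho>_def by metis
  have le: "set_poly F x \<le> H ^ (t - 1)"
    using bound(2)[of x] x by simp
  have eq_iff: "\<rho> = real t * H ^ (t - 1) \<longleftrightarrow> set_poly F x = H ^ (t - 1)"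
    using t by (simp add: \<rho>)
  have "\<rho> = real t * H ^ (t - 1) \<longleftrightarrow>
      complete_regular_partite_isolated (clique_number V E) V (clique_edges V E t)"
  proof
    assume "\<rho> = real t * H ^ (t - 1)"
    then have "set_poly F x = H ^ (t - 1) * (\<Sum>v\<in>V. x v ^ t)"
      using eq_iff x(2) by simp
    then obtain m where eq: "set_poly F x = (\<Sum>v\<in>W. root t (vertex_density V E t v) * x v) ^ t"
      and m: "0 < m" "\<And>v. v \<in> V \<Longrightarrow> x v = m * root (t * (t - 1)) (vertex_density V E t v)"
      using bound(3)[of x] x by blast
    have "complete_regular_partite (clique_number V E) W (clique_edges V E t)"
      by (rule equality_imp_multipartite[OF assms(1) t W_def eq[unfolded F_def] m])
    moreover have "W \<subseteq> V"
      by (auto simp: W_def)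
    ultimately show "complete_regular_partite_isolated (clique_number V E) V (clique_edges V E t)"
      unfolding complete_regular_partite_isolated_def by (intro exI conjI)
  next
    assume "complete_regular_partite_isolated (clique_number V E) V (clique_edges V E t)"
    then obtain U where U: "U \<subseteq> V" "complete_regular_partite (clique_number V E) U (clique_edges V E t)"
      unfolding complete_regular_partite_isolated_def by blast
    define y :: "'a \<Rightarrow> real" where "y v = (if v \<in> U then 1 else 0)" for v
    have "set_poly F y = H ^ (t - 1) * real (card U)"
      unfolding F_def H_def y_def by (rule multipartite_imp_equality[OF V t U])
    moreover have "(\<Sum>v\<in>V. y v ^ t) = real (card U)"
    proof -
      have "(\<Sum>v\<in>V. y v ^ t) = (\<Sum>v\<in>U. 1)"
        using t by (intro sum.mono_neutral_cong_right[OF V U(1)]) (auto simp: y_def)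
      then show ?thesis
        by simp
    qed
    moreover have "0 < card U"
    proof -
      have "U \<noteq> {}"
        using U(2) t by (auto simp: complete_regular_partite_def partition_on_empty)
      then show ?thesis
        using V U(1) finite_subset by (auto simp: card_gt_0_iff)
    qed
    ultimately have "H ^ (t - 1) \<le> set_poly F x"
      using max[of y] by (simp add: y_def)
    then show "\<rho> = real t * H ^ (t - 1)"
      using le eq_iff by simp
  qed
  moreover have "\<rho> \<le> real t * H ^ (t - 1)"
    using le by (simp add: \<rho> mult_left_mono)
  ultimately show "clique_spectral_radius V E t \<le> real t * (\<Sum>v\<in>V. root (t - 1) (vertex_density V E t v)) ^ (t - 1) \<and>
    (clique_spectral_radius V E t = real t * (\<Sum>v\<in>V. root (t - 1) (vertex_density V E t v)) ^ (t - 1)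
      \<longleftrightarrow> complete_regular_partite_isolated (clique_number V E) V (clique_edges V E t))"
    unfolding H_def \<rho>_def by blast
qed

end
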